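(* Let $(X,\|\cdot\|)$ be an Asplund space and let $f:X\to(-\infty,+\infty]$ be any proper function. Then there exists a rich rectangle-family $\mathcal R\subset\mathcal S_{\square}(X\times X^* )$ such that $Y_1\subset Y_2$ whenever $V_1\times Y_1,\ V_2\times Y_2\in\mathcal R$ and $V_1\subset V_2$, and such that for every $V\times Y\in\mathcal R$ the assignment $Y\ni x^*\longmapsto x^*|_V\in V^*$ is an isometry from $Y$ onto $V^*$ and for every $v\in V$ we have $$\big(\partial_Ff(v)\cap Y\big)|_V=\big(\partial_Ff(v)\big)|_V=\partial_F(f|_V)(v).$$
   Context: A Banach space is Asplund if every convex continuous function on it is Fréchet differentiable at some point (equivalently, every separable subspace of it has separable dual). For a Banach space $Z$, $\mathcal S(Z)$ is the family of all separable closed subspaces of $Z$. For $B\subset X^*$ and $V\subset X$, $B|_V:=\{x^*|_V:\ x^*\in B\}$. $\mathcal S_{\square}(X\times X^* )$ is the family of all rectangles $V\times Y$ with $V\in\mathcal S(X)$, $Y\in\mathcal S(X^* )$, ordered by inclusion. Any subset $\mathcal R$ of it is called a rectangle-family. $\mathcal R$ is cofinal if every element of $\mathcal S_{\square}(X\times X^* )$ is contained in some element of $\mathcal R$. It is $\sigma$-complete if for every increasing sequence $V_1\times Y_1\subset V_2\times Y_2\subset\cdots$ in $\mathcal R$ its supremum $\overline{\bigcup_i V_i}\times\overline{\bigcup_i Y_i}$ belongs to $\mathcal R$. It is rich if it is both cofinal and $\sigma$-complete. A function $f:X\to(-\infty,+\infty]$ is proper if $f\not\equiv+\infty$. If $f(x)<+\infty$,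 the Fréchet subdifferential $\partial_Ff(x)$ is the (possibly empty) set of all $x^*\in X^*$ such that for every $\varepsilon>0$ there is $\delta>0$ with $\frac1{\|h\|}\big(f(x+h)-f(x)-\langle x^*,h\rangle\big)>-\varepsilon$ whenever $h\in X$ and $0<\|h\|<\delta$; if $f(x)=+\infty$, put $\partial_Ff(x)=\emptyset$. $\partial_F(f|_V)(v)\subset V^*$ is defined in the same way in the Banach space $V$. *)

theory Defs
  imports "HOL-Analysis.Analysis"
begin

(* A real Banach space X is a type of class banach; its dual X* is the type of bounded linear
   functions into the reals, with the operator norm. *)

(* differentiable is Frechet differentiability. *)
definition asplund_space :: "'a::banach itself \<Rightarrow> bool" where
  "asplund_space _ \<longleftrightarrow>
     (\<forall>\<phi> :: 'a \<Rightarrow> real. convex_on UNIV \<phi> \<and> continuous_on UNIV \<phi> \<longrightarrow>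
        (\<exists>x. \<phi> differentiable (at x)))"

definition separable_closed_subspaces :: "'a::real_normed_vector set set" where
  "separable_closed_subspaces = {V. subspace V \<and> closed V \<and> separable_space (top_of_set V)}"

definition rectangles :: "('a::banach \<times> ('a \<Rightarrow>\<^sub>L real)) set set" where
  "rectangles = {V \<times> Y | V Y. V \<in> separable_closed_subspaces \<and> Y \<in> separable_closed_subspaces}"

definition cofinal_family :: "('a::banach \<times> ('a \<Rightarrow>\<^sub>L real)) set set \<Rightarrow> bool" where
  "cofinal_family \<R> \<longleftrightarrow> (\<forall>S\<in>rectangles. \<exists>R\<in>\<R>. S \<subseteq> R)"

definition sigma_complete_family :: "('a::banach \<times> ('a \<Rightarrow>\<^sub>L real)) set set \<Rightarrow> bool" where
  "sigma_complete_family \<R> \<longleftrightarrow>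
     (\<forall>(V :: nat \<Rightarrow> 'a set) (Y :: nat \<Rightarrow> ('a \<Rightarrow>\<^sub>L real) set).
        (\<forall>i. V i \<times> Y i \<in> \<R>) \<and> (\<forall>i. V i \<times> Y i \<subseteq> V (Suc i) \<times> Y (Suc i)) \<longrightarrow>
        closure (\<Union>i. V i) \<times> closure (\<Union>i. Y i) \<in> \<R>)"

definition rich_rectangle_family :: "('a::banach \<times> ('a \<Rightarrow>\<^sub>L real)) set set \<Rightarrow> bool" where
  "rich_rectangle_family \<R> \<longleftrightarrow>
     \<R> \<subseteq> rectangles \<and> cofinal_family \<R> \<and> sigma_complete_family \<R>"

(* The dual V* of a subspace V.  A functional on V is a function extensional on V,
   so that equality in V* is equality of functions. *)
definition dual_on :: "'a::real_normed_vector set \<Rightarrow> ('a \<Rightarrow> real) set" where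
  "dual_on V = {g \<in> extensional V.
     (\<forall>x\<in>V. \<forall>y\<in>V. g (x + y) = g x + g y) \<and>
     (\<forall>c. \<forall>x\<in>V. g (c *\<^sub>R x) = c * g x) \<and>
     (\<exists>K. \<forall>x\<in>V. \<bar>g x\<bar> \<le> K * norm x)}"

definition dual_norm_on :: "'a::real_normed_vector set \<Rightarrow> ('a \<Rightarrow> real) \<Rightarrow> real" where
  "dual_norm_on V g = (SUP v\<in>{v\<in>V. norm v \<le> 1}. \<bar>g v\<bar>)"

definition dual_dist_on :: "'a::real_normed_vector set \<Rightarrow> ('a \<Rightarrow> real) \<Rightarrow> ('a \<Rightarrow> real) \<Rightarrow> real" where
  "dual_dist_on V g h = dual_norm_on V (\<lambda>v\<in>V. g v - h v)"

definition restrict_functional ::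
    "'a::real_normed_vector set \<Rightarrow> ('a \<Rightarrow>\<^sub>L real) \<Rightarrow> ('a \<Rightarrow> real)" where
  "restrict_functional V xs = restrict (blinfun_apply xs) V"

definition isometry_onto_dual ::
    "('a::real_normed_vector \<Rightarrow>\<^sub>L real) set \<Rightarrow> 'a set \<Rightarrow> bool" where
  "isometry_onto_dual Y V \<longleftrightarrow>
     restrict_functional V ` Y = dual_on V \<and>
     (\<forall>xs\<in>Y. \<forall>ys\<in>Y.
        dual_dist_on V (restrict_functional V xs) (restrict_functional V ys) = dist xs ys)"

(* The defining inequality of a Frechet subgradient, with increments taken in the subspace V.
   No undefined ereal arithmetic occurs: f never takes the value -infinity in what follows, and
   f x is finite here. *)
definition frechet_subgradient_on ::
    "'a::real_normed_vector set \<Rightarrow> ('a \<Rightarrow> ereal) \<Rightarrow> 'a \<Rightarrow> ('a \<Rightarrow> real) \<Rightarrow> bool" where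
  "frechet_subgradient_on V f x g \<longleftrightarrow> f x < \<infinity> \<and>
     (\<forall>\<epsilon>>0. \<exists>\<delta>>0. \<forall>h\<in>V. 0 < norm h \<and> norm h < \<delta> \<longrightarrow>
        ereal (1 / norm h) * (f (x + h) - f x - ereal (g h)) > ereal (- \<epsilon>))"

definition frechet_subdiff ::
    "('a::real_normed_vector \<Rightarrow> ereal) \<Rightarrow> 'a \<Rightarrow> ('a \<Rightarrow>\<^sub>L real) set" where
  "frechet_subdiff f x = {xs. frechet_subgradient_on UNIV f x (blinfun_apply xs)}"

(* The subdifferential of the restriction of f to V, at a point v of V; only the values of f on V
   enter. *)
definition frechet_subdiff_on ::
    "'a::real_normed_vector set \<Rightarrow> ('a \<Rightarrow> ereal) \<Rightarrow> 'a \<Rightarrow> ('a \<Rightarrow> real) set" where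
  "frechet_subdiff_on V f v = {g \<in> dual_on V. frechet_subgradient_on V f v g}"

end

theory Submission
  imports Defs
begin

text \<open>The generator. By Asplundness, every bounded set of functionals has small slices. Apply this to a
  minimal pointwise closed set meeting the duality map \<open>J\<close> over a given set \<open>A\<close>: over some relatively
  open piece of \<open>A\<close>, a single functional is close to all the sets \<open>J x\<close>. A transfinite exhaustion
  turns these local choices into a countable-valued map \<open>g\<close> with \<open>{x. \<xi> \<in> g x}\<close> open, whose values at
  \<open>x\<close> approximate \<open>J x\<close> arbitrarily well. A Simons-type argument then shows that, for separable \<open>V\<close>, the
  values of \<open>g\<close> on \<open>V\<close> span a space whose restrictions are dense in the dual of \<open>V\<close>.

  The rectangles. Let \<open>Y\<close> be the closed span of these values; it is monotone in \<open>V\<close> and, since the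
  sets \<open>{x. \<xi> \<in> g x}\<close> are open, it commutes with closures of increasing unions. Keep those \<open>V\<close> which norm
  \<open>Y\<close> and which, for \<open>v \<in> V\<close> and \<open>y \<in> Y\<close>, contain a solution of \<open>a < \<parallel>x - v\<parallel> < b\<close>, \<open>f x < c + \<langle>y, x\<rangle>\<close>
  whenever the whole space contains one. The first property makes restriction an isometry onto
  the dual of \<open>V\<close>, the second one lifts Frechet subgradients from \<open>V\<close> to the whole space.\<close>

section \<open>Extension of functionals\<close>

lemma exists_between_sets:
  fixes A B :: "real set"
  assumes "A \<noteq> {}" "B \<noteq> {}" "\<And>a b. a \<in> A \<Longrightarrow> b \<in> B \<Longrightarrow> a \<le> b"
  shows "\<exists>t. (\<forall>a\<in>A. a \<le> t) \<and> (\<forall>b\<in>B. t \<le> b)"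
proof (intro exI[of _ "Sup A"] conjI ballI)
  have "bdd_above A"
    using assms(2,3) by (meson bdd_above.I ex_in_conv)
  then show "a \<le> Sup A" if "a \<in> A" for a
    using that by (rule cSup_upper[rotated])
  show "Sup A \<le> b" if "b \<in> B" for b
    using assms that by (intro cSup_least) auto
qed

text \<open>Partial functionals are represented by their graphs, so that the bound alone forces
  single-valuedness.\<close>

lemma dominated_graph_extend:
  fixes S :: "('a::real_normed_vector \<times> real) set"
  assumes S: "subspace S" and dom': "\<forall>x t. (x, t) \<in> S \<longrightarrow> t \<le> K * norm x" and K: "0 \<le> K"
  shows "\<exists>S'. subspace S' \<and> S \<subseteq> S' \<and> (\<forall>x t. (x, t) \<in> S' \<longrightarrow> t \<le> K * norm x) \<and> x0 \<in> fst ` S'"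
proof -
  note dom = dom'[rule_format]
  \<comment> \<open>A value \<open>t0\<close> at \<open>x0\<close> is admissible as soon as the
    bound survives adding or subtracting \<open>x0\<close> once; scaling handles all other
    multiples.\<close>
  have "\<exists>t0. (\<forall>a\<in>(\<lambda>(x, t). t - K * norm (x - x0)) ` S. a \<le> t0) \<and>
             (\<forall>b\<in>(\<lambda>(x, t). K * norm (x + x0) - t) ` S. t0 \<le> b)"
  proof (rule exists_between_sets)
    show "(\<lambda>(x, t). t - K * norm (x - x0)) ` S \<noteq> {}" "(\<lambda>(x, t). K * norm (x + x0) - t) ` S \<noteq> {}"
      using subspace_0[OF S] by auto
    fix a b assume "a \<in> (\<lambda>(x, t). t - K * norm (x - x0)) ` S" "b \<in> (\<lambda>(x, t). K * norm (x + x0) - t) ` S"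
    then obtain x t y s where *: "(x, t) \<in> S" "(y, s) \<in> S"
      and ab: "a = t - K * norm (x - x0)" "b = K * norm (y + x0) - s" by auto
    have "(x + y, t + s) \<in> S" using subspace_add[OF S *] by simp
    then have "t + s \<le> K * norm (x + y)" by (rule dom)
    also have "\<dots> \<le> K * (norm (x - x0) + norm (y + x0))"
      using norm_triangle_ineq[of "x - x0" "y + x0"] K by (intro mult_left_mono) auto
    finally show "a \<le> b" unfolding ab by (simp add: algebra_simps)
  qed
  then obtain t0 where lo: "\<And>x t. (x, t) \<in> S \<Longrightarrow> t - K * norm (x - x0) \<le> t0"
    and hi: "\<And>x t. (x, t) \<in> S \<Longrightarrow> t0 \<le> K * norm (x + x0) - t" by fastforce
  let ?S = "span (insert (x0, t0) S)"
  have "t \<le> K * norm x" if xt: "(x, t) \<in> ?S" for x t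
  proof -
    obtain k where k: "(x - k *\<^sub>R x0, t - k * t0) \<in> S"
      using xt unfolding span_breakdown_eq span_eq_iff[THEN iffD2, OF S] by auto
    consider "k = 0" | "k > 0" | "k < 0" by linarith
    then show ?thesis
    proof cases
      case 1 then show ?thesis using k dom by simp
    next
      case 2
      have "((1/k) *\<^sub>R (x - k *\<^sub>R x0), (1/k) * (t - k * t0)) \<in> S"
        using subspace_scale[OF S k, of "1/k"] by simp
      from hi[OF this] have "t0 \<le> K * norm ((1/k) *\<^sub>R x) - (t/k - t0)"
        using 2 by (simp add: algebra_simps diff_divide_distrib)
      then show ?thesis using 2 by (simp add: divide_le_cancel)
    next
      case 3
      have "((-1/k) *\<^sub>R (x - k *\<^sub>R x0), (-1/k) * (t - k * t0)) \<in> S"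
        using subspace_scale[OF S k, of "-1/k"] by simp
      from lo[OF this] have "(-t/k + t0) - K * norm ((-1/k) *\<^sub>R x) \<le> t0"
        using 3 by (simp add: algebra_simps diff_divide_distrib)
      then show ?thesis using 3 by (simp add: divide_le_cancel)
    qed
  qed
  moreover have "(x0, t0) \<in> ?S" by (simp add: span_base)
  then have "x0 \<in> fst ` ?S" by force
  moreover have "S \<subseteq> ?S" by (meson insertI2 span_base subsetI)
  ultimately show ?thesis by (intro exI[of _ ?S]) auto
qed

text \<open>Zorn's lemma is applied to the dominated linear graphs containing that of
  \<open>g\<close>; a maximal one has full domain by \<open>dominated_graph_extend\<close>. The
  one-sided bound, used at \<open>x\<close> and \<open>- x\<close>, controls the absolute
  value.\<close>

lemma Hahn_Banach:
  fixes g :: "'a::real_normed_vector \<Rightarrow> real"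
  assumes V: "subspace V"
    and add: "\<And>x y. x \<in> V \<Longrightarrow> y \<in> V \<Longrightarrow> g (x + y) = g x + g y"
    and scale: "\<And>c x. x \<in> V \<Longrightarrow> g (c *\<^sub>R x) = c * g x"
    and K: "0 \<le> K" and bound: "\<And>x. x \<in> V \<Longrightarrow> g x \<le> K * norm x"
  shows "\<exists>F :: 'a \<Rightarrow>\<^sub>L real. (\<forall>x\<in>V. blinfun_apply F x = g x) \<and> norm F \<le> K"
proof -
  let ?S0 = "(\<lambda>x. (x, g x)) ` V"
  define \<A> where "\<A> = {S. subspace S \<and> ?S0 \<subseteq> S \<and> (\<forall>x t. (x, t) \<in> S \<longrightarrow> t \<le> K * norm x)}"
  have g0: "g 0 = 0" using scale[of 0 0] subspace_0[OF V] by simp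
  have "subspace ?S0"
    unfolding subspace_def
  proof (intro conjI ballI allI)
    show "0 \<in> ?S0" using subspace_0[OF V] g0 by (auto simp: zero_prod_def)
    show "x + y \<in> ?S0" if "x \<in> ?S0" "y \<in> ?S0" for x y
      using that subspace_add[OF V] by (auto simp: add image_iff)
    show "c *\<^sub>R x \<in> ?S0" if "x \<in> ?S0" for c x
      using that subspace_scale[OF V] by (auto simp: scale image_iff)
  qed
  then have "?S0 \<in> \<A>" using bound by (auto simp: \<A>_def)
  moreover have "\<Union>\<C> \<in> \<A>" if ne: "\<C> \<noteq> {}" and ch: "subset.chain \<A> \<C>" for \<C>
  proof -
    have sub: "\<And>S. S \<in> \<C> \<Longrightarrow> S \<in> \<A>" using ch by (auto simp: subset_chain_def)
    have sp: "subspace S" if "S \<in> \<C>" for S using sub[OF that] by (simp add: \<A>_def)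
    obtain S1 where S1: "S1 \<in> \<C>" using ne by blast
    have "subspace (\<Union>\<C>)"
      unfolding subspace_def
    proof (intro conjI ballI allI)
      show "0 \<in> \<Union>\<C>" using S1 subspace_0[OF sp[OF S1]] by blast
      show "x + y \<in> \<Union>\<C>" if xy: "x \<in> \<Union>\<C>" "y \<in> \<Union>\<C>" for x y
      proof -
        obtain S S' where S: "S \<in> \<C>" "x \<in> S" "S' \<in> \<C>" "y \<in> S'" using xy by blast
        then consider "S \<subseteq> S'" | "S' \<subseteq> S" using ch unfolding subset_chain_def by blast
        then show ?thesis
          using S subspace_add[OF sp[OF S(1)], of x y] subspace_add[OF sp[OF S(3)], of x y] by cases blast+
      qed
      show "c *\<^sub>R x \<in> \<Union>\<C>" if "x \<in> \<Union>\<C>" for c x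
        using that subspace_scale[OF sp, of _ x c] by blast
    qed
    moreover have "?S0 \<subseteq> \<Union>\<C>" using S1 sub[OF S1] unfolding \<A>_def by blast
    moreover have "t \<le> K * norm x" if xt: "(x, t) \<in> \<Union>\<C>" for x t
    proof -
      obtain S where "S \<in> \<C>" "(x, t) \<in> S" using xt by blast
      then show ?thesis using sub[of S] unfolding \<A>_def by blast
    qed
    ultimately show ?thesis unfolding \<A>_def by blast
  qed
  ultimately obtain M where M: "M \<in> \<A>" and max: "\<And>S. S \<in> \<A> \<Longrightarrow> M \<subseteq> S \<Longrightarrow> S = M"
    using subset_Zorn_nonempty[of \<A>] by blast
  have sM: "subspace M" and dom': "\<forall>x t. (x, t) \<in> M \<longrightarrow> t \<le> K * norm x" and S0M: "?S0 \<subseteq> M"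
    using M unfolding \<A>_def by blast+
  note dom = dom'[rule_format]
  have dom_M: "x \<in> fst ` M" for x
  proof -
    obtain S' where S': "subspace S'" "M \<subseteq> S'" "\<forall>x t. (x, t) \<in> S' \<longrightarrow> t \<le> K * norm x" "x \<in> fst ` S'"
      using dominated_graph_extend[of M K x, OF sM dom' K] by blast
    then have "S' \<in> \<A>" using S0M unfolding \<A>_def by blast
    from max[OF this S'(2)] S'(4) show ?thesis by simp
  qed
  have "\<exists>t. (x, t) \<in> M" for x
  proof -
    obtain p where "p \<in> M" "x = fst p" using dom_M[of x] by blast
    then show ?thesis by (intro exI[of _ "snd p"]) simp
  qed
  then have "\<exists>h. \<forall>x. (x, h x) \<in> M" by (intro choice allI)
  then obtain h where h: "\<And>x. (x, h x) \<in> M" by blast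
  have uniq: "t = h x" if "(x, t) \<in> M" for x t
    using dom[of 0 "t - h x"] dom[of 0 "h x - t"] subspace_diff[OF sM that h[of x]]
      subspace_diff[OF sM h[of x] that] by simp
  have hadd: "h (x + y) = h x + h y" for x y
    using uniq[of "x + y" "h x + h y"] subspace_add[OF sM h[of x] h[of y]] by simp
  have hscale: "h (c *\<^sub>R x) = c * h x" for c x
    using uniq[of "c *\<^sub>R x" "c * h x"] subspace_scale[OF sM h[of x], of c] by simp
  have hle: "\<bar>h x\<bar> \<le> K * norm x" for x
    using dom[OF h[of x]] dom[OF h[of "- x"]] hscale[of "-1" x] by auto
  have bl: "bounded_linear h"
    by (rule bounded_linear_intro[where K = K])
      (use hadd hscale hle in \<open>auto simp: mult.commute\<close>)
  show ?thesis
  proof (intro exI conjI ballI)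
    show "Blinfun h x = g x" if "x \<in> V" for x
      using uniq[of x "g x"] that S0M by (auto simp: bounded_linear_Blinfun_apply[OF bl])
    show "norm (Blinfun h) \<le> K"
      by (rule norm_blinfun_bound) (use K hle in \<open>auto simp: bounded_linear_Blinfun_apply[OF bl]\<close>)
  qed
qed

lemma norming_functional:
  fixes x :: "'a::real_normed_vector"
  shows "\<exists>j :: 'a \<Rightarrow>\<^sub>L real. norm j \<le> 1 \<and> blinfun_apply j x = norm x"
proof (cases "x = 0")
  case True
  then show ?thesis by (intro exI[of _ 0]) auto
next
  case False
  define g where "g y = (SOME c. y = c *\<^sub>R x) * norm x" for y
  have g: "g (c *\<^sub>R x) = c * norm x" for c
    using False by (simp add: g_def)
  have "\<exists>F :: 'a \<Rightarrow>\<^sub>L real. (\<forall>y\<in>span {x}. blinfun_apply F y = g y) \<and> norm F \<le> 1"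
  proof (rule Hahn_Banach)
    show "g (y + z) = g y + g z" if yz: "y \<in> span {x}" "z \<in> span {x}" for y z
    proof -
      obtain a b where "y = a *\<^sub>R x" "z = b *\<^sub>R x" using yz by (auto simp: span_singleton)
      then show ?thesis using g[of "a + b"] g[of a] g[of b] by (simp add: algebra_simps)
    qed
    show "g (c *\<^sub>R y) = c * g y" if y: "y \<in> span {x}" for c y
    proof -
      obtain a where "y = a *\<^sub>R x" using y by (auto simp: span_singleton)
      then show ?thesis using g[of "c * a"] g[of a] by simp
    qed
    show "g y \<le> 1 * norm y" if y: "y \<in> span {x}" for y
    proof -
      obtain a where "y = a *\<^sub>R x" using y by (auto simp: span_singleton)
      then show ?thesis using g[of a] by (simp add: mult_right_mono)
    qed
  qed auto
  then show ?thesis using g[of 1] by (auto simp: span_base)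
qed

text \<open>Induction on \<open>n\<close>, passing from \<open>V\<close> to the kernel of
  \<open>\<xi> n\<close> in \<open>V\<close>. A vector \<open>u\<close> with
  \<open>\<xi> n u = 1\<close> then determines which multiple of \<open>\<xi> n\<close> must be
  added.\<close>

lemma common_kernel_span:
  fixes \<xi> :: "nat \<Rightarrow> 'a::real_normed_vector \<Rightarrow>\<^sub>L real"
  assumes "subspace V" "\<And>x. x \<in> V \<Longrightarrow> (\<forall>i<n. blinfun_apply (\<xi> i) x = 0) \<Longrightarrow> blinfun_apply h x = 0"
  shows "\<exists>\<eta>\<in>span (\<xi> ` {..<n}). \<forall>x\<in>V. blinfun_apply h x = blinfun_apply \<eta> x"
  using assms
proof (induction n arbitrary: V h)
  case 0
  then show ?case by auto
next
  case (Suc n)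
  note V = Suc.prems(1)
  let ?W = "{x \<in> V. \<xi> n x = 0}"
  have W: "subspace ?W"
    using V by (auto simp: subspace_def blinfun.add_right blinfun.scaleR_right)
  have mono: "span (\<xi> ` {..<n}) \<subseteq> span (\<xi> ` {..<Suc n})"
    by (intro span_mono image_mono) auto
  obtain \<eta> where \<eta>: "\<eta> \<in> span (\<xi> ` {..<n})" "\<And>x. x \<in> ?W \<Longrightarrow> h x = \<eta> x"
    using Suc.IH[OF W, of h] Suc.prems(2) by (auto simp: less_Suc_eq)
  show ?case
  proof (cases "?W = V")
    case True
    then show ?thesis using \<eta> mono by blast
  next
    case False
    then obtain u0 where u0: "u0 \<in> V" "\<xi> n u0 \<noteq> 0" by auto
    define u where "u = (1 / \<xi> n u0) *\<^sub>R u0"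
    have u: "u \<in> V" "\<xi> n u = 1"
      using u0 subspace_scale[OF V] by (auto simp: u_def blinfun.scaleR_right)
    define c where "c = h u - \<eta> u"
    have "\<xi> n \<in> span (\<xi> ` {..<Suc n})" by (rule span_base) auto
    then have "\<eta> + c *\<^sub>R \<xi> n \<in> span (\<xi> ` {..<Suc n})"
      using \<eta>(1) mono by (auto intro!: span_add span_scale)
    moreover have "h x = (\<eta> + c *\<^sub>R \<xi> n) x" if x: "x \<in> V" for x
    proof -
      have "x - \<xi> n x *\<^sub>R u \<in> ?W"
        using x u V by (auto simp: blinfun.diff_right blinfun.scaleR_right subspace_diff subspace_scale)
      from \<eta>(2)[OF this] show ?thesis
        unfolding c_def blinfun.diff_right blinfun.scaleR_right blinfun.add_left blinfun.scaleR_left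
        by (simp add: algebra_simps)
    qed
    ultimately show ?thesis by blast
  qed
qed

text \<open>Otherwise \<open>g\<close> is bounded by \<open>d\<close> on the common kernel and
  extends from there to some \<open>F\<close> of norm at most \<open>d\<close>. Then
  \<open>g - F\<close> vanishes on the common kernel, so on \<open>V\<close> it agrees with an
  element of the span, and the error \<open>F\<close> contradicts \<open>far\<close>.\<close>

lemma large_on_common_kernel:
  fixes \<xi> :: "nat \<Rightarrow> 'a::real_normed_vector \<Rightarrow>\<^sub>L real"
  assumes V: "subspace V" and d: "0 \<le> d"
    and far: "\<And>\<eta>. \<eta> \<in> span (\<xi> ` {..<n}) \<Longrightarrow> \<exists>v\<in>V. \<bar>blinfun_apply g v - blinfun_apply \<eta> v\<bar> > d * norm v"
  shows "\<exists>x\<in>V. (\<forall>i<n. \<xi> i x = 0) \<and> blinfun_apply g x > d * norm x"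
proof (rule ccontr)
  assume neg: "\<not> ?thesis"
  let ?W = "{x \<in> V. \<forall>i<n. \<xi> i x = 0}"
  have W: "subspace ?W"
    using V by (auto simp: subspace_def blinfun.add_right blinfun.scaleR_right)
  obtain F :: "'a \<Rightarrow>\<^sub>L real" where F: "\<forall>x\<in>?W. F x = g x" "norm F \<le> d"
    using Hahn_Banach[OF W, of g d] neg d
    by (force simp: blinfun.add_right blinfun.scaleR_right not_less)
  obtain \<eta> where \<eta>: "\<eta> \<in> span (\<xi> ` {..<n})" "\<forall>x\<in>V. (g - F) x = \<eta> x"
    using common_kernel_span[OF V, of n \<xi> "g - F"] F(1) by (auto simp: blinfun.diff_left)
  from far[OF \<eta>(1)] obtain v where v: "v \<in> V" "\<bar>g v - \<eta> v\<bar> > d * norm v" by blast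
  have "g v - \<eta> v = F v" using \<eta>(2) v(1) by (auto simp: blinfun.diff_left algebra_simps)
  moreover have "\<bar>F v\<bar> \<le> d * norm v"
    using norm_blinfun[of F v] mult_right_mono[OF F(2) norm_ge_zero[of v]] by simp
  ultimately show False using v(2) by simp
qed

section \<open>Approximate boundaries\<close>

text \<open>A Simons-type argument. If \<open>g\<close> were far from the span, one could choose \<open>y n\<close> in the unit ball
  of \<open>V\<close>, annihilated by the first \<open>n\<close> functionals, with \<open>g (y n)\<close> large. Choosing them almost
  minimally makes every functional that norms \<open>z = (\<Sum>n. (1/2)^(n+1) y n)\<close> large on the tails of this
  series, which is impossible for a functional close to some \<open>\<xi> i\<close>.\<close>

lemma near_boundary_span:
  fixes \<xi> :: "nat \<Rightarrow> 'a::banach \<Rightarrow>\<^sub>L real"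
  assumes V: "subspace V" "closed V" and e: "0 < e"
    and near: "\<And>x. x \<in> V \<Longrightarrow> \<exists>i j. norm j \<le> 1 \<and> blinfun_apply j x = norm x \<and> norm (j - \<xi> i) \<le> e"
  shows "\<exists>\<eta>\<in>span (range \<xi>). \<forall>v\<in>V. \<bar>blinfun_apply g v - blinfun_apply \<eta> v\<bar> \<le> 2 * e * norm g * norm v"
proof (rule ccontr)
  assume neg: "\<not> ?thesis"
  define d where "d = 2 * e * norm g"
  have g0: "norm g > 0"
    using neg span_zero[of "range \<xi>"] by (cases "g = 0") auto
  then have d: "d > 0" using e by (simp add: d_def)
  \<comment> \<open>These convex sets decrease with \<open>n\<close>; the negated claim makes them
    nonempty, through \<open>large_on_common_kernel\<close> and normalisation.\<close>
  define C where "C n = {x\<in>V. norm x \<le> 1 \<and> (\<forall>i<n. blinfun_apply (\<xi> i) x = 0) \<and> d \<le> g x}" for n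
  have C_ne: "C n \<noteq> {}" for n
  proof -
    have "\<exists>x\<in>V. (\<forall>i<n. \<xi> i x = 0) \<and> blinfun_apply g x > d * norm x"
    proof (rule large_on_common_kernel[OF V(1)])
      fix \<eta> assume "\<eta> \<in> span (\<xi> ` {..<n})"
      then have "\<eta> \<in> span (range \<xi>)" by (meson span_mono subsetD image_mono subset_UNIV)
      then show "\<exists>v\<in>V. \<bar>g v - \<eta> v\<bar> > d * norm v" using neg by (force simp: d_def)
    qed (use d in simp)
    then obtain x where x: "x \<in> V" "\<forall>i<n. \<xi> i x = 0" "g x > d * norm x" by blast
    then have "x \<noteq> 0" by (auto simp: blinfun.zero_right)
    then have "(1 / norm x) *\<^sub>R x \<in> C n"
      using x subspace_scale[OF V(1)] by (auto simp: C_def blinfun.scaleR_right field_simps)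
    then show ?thesis by blast
  qed
  have C_Suc: "C (Suc n) \<subseteq> C n" for n by (auto simp: C_def)
  have C_mid: "(1/2) *\<^sub>R (x + y) \<in> C n" if "x \<in> C n" "y \<in> C n" for n x y
    using that norm_triangle_ineq[of x y] subspace_add[OF V(1)] subspace_scale[OF V(1)]
    by (auto simp: C_def blinfun.scaleR_right blinfun.add_right)
  define q :: real where "q = 1/2"
  \<comment> \<open>The weight \<open>q^n\<close> is the total mass left after \<open>n\<close>
    terms, so the vector minimised is the sum that would result from using \<open>y\<close> for all
    remaining terms. The tolerance is quadratic in \<open>q^n\<close> so that the errors, relative
    to \<open>q^n\<close>, stay summable.\<close>
  have "\<exists>y\<in>C n. \<forall>y'\<in>C n. norm (z + q^n *\<^sub>R y) \<le> norm (z + q^n *\<^sub>R y') + e / 4 * (q^n * q^n)" for n z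
  proof -
    let ?A = "(\<lambda>y. norm (z + q^n *\<^sub>R y)) ` C n"
    have bb: "bdd_below ?A" by (rule bdd_belowI2[of _ 0]) auto
    have "Inf ?A < Inf ?A + e / 4 * (q^n * q^n)" using e by (simp add: q_def)
    then obtain y where y: "y \<in> C n" "norm (z + q^n *\<^sub>R y) < Inf ?A + e / 4 * (q^n * q^n)"
      using C_ne[of n] bb by (subst (asm) cInf_less_iff) auto
    have "Inf ?A \<le> norm (z + q^n *\<^sub>R y')" if "y' \<in> C n" for y'
      using that bb by (intro cInf_lower) auto
    then show ?thesis using y by force
  qed
  then obtain c where c: "\<And>n z. c n z \<in> C n"
    and cmin: "\<And>n z y'. y' \<in> C n \<Longrightarrow> norm (z + q^n *\<^sub>R c n z) \<le> norm (z + q^n *\<^sub>R y') + e / 4 * (q^n * q^n)"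
    by metis
  define z where "z = rec_nat 0 (\<lambda>n w. w + q^Suc n *\<^sub>R c n w)"
  define y where "y n = c n (z n)" for n
  have z0: "z 0 = 0" and zS: "z (Suc n) = z n + q^Suc n *\<^sub>R y n" for n
    by (simp_all add: z_def y_def)
  have yC: "y n \<in> C n" for n by (simp add: y_def c)
  have z_sum: "z n = (\<Sum>k<n. q^Suc k *\<^sub>R y k)" for n
    by (induction n) (auto simp: z0 zS)
  have ny: "norm (y n) \<le> 1" for n using yC[of n] by (simp add: C_def)
  have "summable (\<lambda>k. q^Suc k *\<^sub>R y k)"
  proof (rule summable_comparison_test')
    show "summable (\<lambda>k. q^Suc k)" by (simp add: q_def summable_geometric)
    show "norm (q^Suc n *\<^sub>R y n) \<le> q^Suc n" for n
      using ny[of n] by (simp add: q_def)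
  qed
  then obtain zz where lim: "z \<longlonglongrightarrow> zz"
    unfolding z_sum[abs_def] using summable_LIMSEQ by blast
  have zV: "z n \<in> V" for n
    unfolding z_sum using yC by (intro subspace_sum[OF V(1)] subspace_scale[OF V(1)]) (auto simp: C_def)
  have zzV: "zz \<in> V" using closed_sequentially[OF V(2) _ lim] zV by blast
  have q: "q > 0" "q + q = 1" by (auto simp: q_def)
  \<comment> \<open>Repeated midpoints: the terms between stages \<open>n\<close> and
    \<open>N\<close>, completed by a last vector of weight \<open>q^N\<close>, average to one
    element of \<open>C n\<close>. That average is the competitor of \<open>y n\<close>.\<close>
  have tail: "\<exists>w'\<in>C n. z N - z n + q^N *\<^sub>R w = q^n *\<^sub>R w'" if "n \<le> N" "w \<in> C N" for n N w
    using that
  proof (induction N arbitrary: w rule: dec_induct)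
    case base
    then show ?case by auto
  next
    case (step N)
    have "(1/2) *\<^sub>R (y N + w) \<in> C N"
      using C_mid yC step.prems C_Suc by blast
    from step.IH[OF this] show ?case
      by (simp add: zS q_def scaleR_add_right algebra_simps)
  qed
  have "norm (z n + q^n *\<^sub>R y n) \<le> norm zz + e / 4 * (q^n * q^n)" for n
  proof (rule LIMSEQ_le_const)
    have "(\<lambda>N. q^N *\<^sub>R y N) \<longlonglongrightarrow> 0"
    proof (rule Lim_null_comparison)
      show "\<forall>\<^sub>F N in sequentially. norm (q^N *\<^sub>R y N) \<le> q^N"
        using ny q by (auto intro!: always_eventually mult_left_le)
      show "(\<lambda>N. q^N) \<longlonglongrightarrow> 0" by (auto simp: q_def intro: LIMSEQ_power_zero)
    qed
    from tendsto_add[OF lim this] have "(\<lambda>N. z N + q^N *\<^sub>R y N) \<longlonglongrightarrow> zz" by simp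
    then show "(\<lambda>N. norm (z N + q^N *\<^sub>R y N) + e / 4 * (q^n * q^n)) \<longlonglongrightarrow> norm zz + e / 4 * (q^n * q^n)"
      by (intro tendsto_intros)
    show "\<exists>N0. \<forall>N\<ge>N0. norm (z n + q^n *\<^sub>R y n) \<le> norm (z N + q^N *\<^sub>R y N) + e / 4 * (q^n * q^n)"
    proof (intro exI[of _ n] allI impI)
      fix N assume "n \<le> N"
      then obtain w' where "w' \<in> C n" "z N - z n + q^N *\<^sub>R y N = q^n *\<^sub>R w'"
        using tail yC by blast
      moreover from this(2) have "z N + q^N *\<^sub>R y N = z n + q^n *\<^sub>R w'" by (simp add: algebra_simps)
      ultimately show "norm (z n + q^n *\<^sub>R y n) \<le> norm (z N + q^N *\<^sub>R y N) + e / 4 * (q^n * q^n)"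
        using cmin[of w' n "z n"] by (simp add: y_def)
    qed
  qed
  moreover have "2 * norm (z (Suc n)) \<le> norm (z n + q^n *\<^sub>R y n) + norm (z n)" for n
  proof -
    have "2 *\<^sub>R z (Suc n) = (z n + q^n *\<^sub>R y n) + z n" by (simp add: zS q_def scaleR_2 algebra_simps)
    then show ?thesis
      by (metis norm_scaleR norm_triangle_ineq abs_numeral)
  qed
  ultimately have *: "2 * norm (z (Suc n)) \<le> norm zz + e / 4 * (q^n * q^n) + norm (z n)" for n
    by (meson add_right_mono order_trans)
  \<comment> \<open>\<open>z (Suc n)\<close> is the midpoint of \<open>z n\<close> and
    \<open>z n + q^n *\<^sub>R y n\<close>. Relative to \<open>q^n\<close>, the lower bound for the
    gap therefore loses \<open>e / 4 * q^k\<close> in step \<open>k\<close>, and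
    \<open>2 - 2 * q^n\<close> sums these powers over \<open>k < n\<close>.\<close>
  have growth: "q^n * (norm zz - e / 4 * (2 - 2 * q^n)) \<le> norm zz - norm (z n)" for n
  proof (induction n)
    case 0
    then show ?case by (simp add: z0)
  next
    case (Suc n)
    then show ?case using *[of n] by (simp add: q_def algebra_simps)
  qed
  obtain i j where j: "norm j \<le> 1" "blinfun_apply j zz = norm zz" "norm (j - \<xi> i) \<le> e"
    using near[OF zzV] by blast
  \<comment> \<open>From index \<open>Suc i\<close> on, \<open>\<xi> i\<close> is among the
    functionals annihilating \<open>y k\<close>, so the nearby \<open>j\<close> is at most
    \<open>e\<close> there.\<close>
  define n where "n = Suc i"
  have jy: "j (y k) \<le> e" if "n \<le> k" for k
  proof -
    have "\<xi> i (y k) = 0" using yC[of k] that by (simp add: C_def n_def)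
    then have "j (y k) = (j - \<xi> i) (y k)" by (simp add: blinfun.diff_left)
    also have "\<dots> \<le> norm (j - \<xi> i) * norm (y k)"
      using norm_blinfun[of "j - \<xi> i" "y k"] by simp
    also have "\<dots> \<le> e * 1" using j(3) ny[of k] e by (intro mult_mono) auto
    finally show ?thesis by simp
  qed
  have "j (z N) - j (z n) \<le> (q^n - q^N) * e" if "n \<le> N" for N
    using that
  proof (induction N rule: dec_induct)
    case base
    then show ?case by simp
  next
    case (step N)
    have "j (z (Suc N)) = j (z N) + q^Suc N * j (y N)"
      by (simp add: zS blinfun.add_right blinfun.scaleR_right)
    moreover have "q^Suc N * j (y N) \<le> q^Suc N * e" using jy[OF step.hyps(1)] q by simp
    moreover have "(q^n - q^Suc N) * e = (q^n - q^N) * e + q^Suc N * e"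
      by (simp add: q_def left_diff_distrib)
    ultimately show ?case using step.IH by linarith
  qed
  then have jle: "j (z N) \<le> j (z n) + q^n * e" if "n \<le> N" for N
    using that e q by (smt (verit) left_diff_distrib mult_pos_pos zero_less_power)
  have "(\<lambda>N. j (z N)) \<longlonglongrightarrow> j zz" by (intro blinfun.tendsto tendsto_const lim)
  then have "j zz \<le> j (z n) + q^n * e"
    by (rule LIMSEQ_le_const2) (use jle in blast)
  moreover have "j (z n) \<le> norm (z n)"
    using norm_blinfun[of j "z n"] mult_right_mono[OF j(1) norm_ge_zero[of "z n"]] by simp
  \<comment> \<open>\<open>j\<close> norms \<open>zz\<close> but gains at most
    \<open>q^n * e\<close> beyond stage \<open>n\<close>, while \<open>growth\<close> bounds the
    same gain from below.\<close>
  ultimately have "q^n * (norm zz - e / 4 * (2 - 2 * q^n)) \<le> q^n * e"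
    using growth[of n] j(2) by linarith
  then have "norm zz - e / 4 * (2 - 2 * q^n) \<le> e" using q by simp
  moreover have "e * (q^n) > 0" using e q by simp
  ultimately have upper: "norm zz \<le> 3/2 * e" by (simp add: algebra_simps)
  \<comment> \<open>The weights sum to 1, so \<open>g zz\<close> is at least
    \<open>d = 2 * e * norm g\<close>, whereas the bound on \<open>norm zz\<close> allows only
    \<open>3/2 * e * norm g\<close>.\<close>
  have "d * (1 - q^N) \<le> g (z N)" for N
  proof (induction N)
    case 0
    then show ?case by (simp add: z0 blinfun.zero_right)
  next
    case (Suc N)
    have "g (z (Suc N)) = g (z N) + q^Suc N * g (y N)"
      by (simp add: zS blinfun.add_right blinfun.scaleR_right)
    moreover have "q^Suc N * d \<le> q^Suc N * g (y N)" using yC[of N] q by (simp add: C_def)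
    moreover have "d * (1 - q^Suc N) = d * (1 - q^N) + q^Suc N * d"
      by (simp add: q_def right_diff_distrib)
    ultimately show ?case using Suc by linarith
  qed
  moreover have "(\<lambda>N. g (z N)) \<longlonglongrightarrow> g zz" by (intro blinfun.tendsto tendsto_const lim)
  moreover have "(\<lambda>N. d * (1 - q^N)) \<longlonglongrightarrow> d * (1 - 0)"
    by (intro tendsto_intros) (auto simp: q_def intro: LIMSEQ_power_zero)
  ultimately have "d \<le> g zz" by (auto intro: LIMSEQ_le)
  also have "\<dots> \<le> norm g * norm zz" using norm_blinfun[of g zz] by simp
  also have "\<dots> \<le> norm g * (3/2 * e)" using upper g0 by simp
  finally show False using g0 e by (simp add: d_def)
qed

section \<open>The duality map of an Asplund space\<close>

text \<open>Functionals are plain functions here, so that the topology of the function type is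
  pointwise convergence, that is, the weak-star topology on the unit ball.\<close>

definition dual_ball :: "('a::real_normed_vector \<Rightarrow> real) set" where
  "dual_ball = {k. linear k \<and> (\<forall>x. \<bar>k x\<bar> \<le> norm x)}"

lemma closed_evaluation_eq: "closed {k :: 'a \<Rightarrow> real. k x = c}"
  and closed_evaluation_le: "closed {k :: 'a \<Rightarrow> real. k x \<le> c}"
  and continuous_evaluation: "continuous_on S (\<lambda>k :: 'a \<Rightarrow> real. k x)"
proof -
  have *: "continuous_on S (\<lambda>k :: 'a \<Rightarrow> real. k x)" for S x
    by (rule continuous_on_subset[OF continuous_on_product_coordinates subset_UNIV])
  then show "continuous_on S (\<lambda>k :: 'a \<Rightarrow> real. k x)" .
  show "closed {k :: 'a \<Rightarrow> real. k x = c}"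
    using closed_Collect_eq[OF *[of UNIV x] continuous_on_const[of UNIV c]] .
  show "closed {k :: 'a \<Rightarrow> real. k x \<le> c}"
    using closed_Collect_le[OF *[of UNIV x] continuous_on_const[of UNIV c]] .
qed

text \<open>Banach-Alaoglu: linearity is a pointwise closed condition inside a product of compact
  intervals.\<close>

lemma compact_dual_ball: "compact (dual_ball :: ('a::real_normed_vector \<Rightarrow> real) set)"
proof -
  let ?B = "PiE UNIV (\<lambda>x::'a. {- norm x..norm x})"
  have "compactin (product_topology (\<lambda>_. euclidean) UNIV) ?B"
    unfolding compactin_PiE by simp
  then have "compact ?B" by (simp add: euclidean_product_topology)
  moreover have "closed {k :: 'a \<Rightarrow> real. linear k}"
    unfolding linear_iff
    by (intro closed_Collect_conj closed_Collect_all closed_Collect_eq continuous_evaluation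
        continuous_intros)
  ultimately have "compact ({k. linear k} \<inter> ?B)"
    by (rule closed_Int_compact[rotated])
  also have "{k. linear k} \<inter> ?B = dual_ball"
    by (auto simp: dual_ball_def PiE_UNIV_domain abs_le_iff minus_le_iff)
  finally show ?thesis .
qed

lemma dual_ball_Blinfun:
  assumes "k \<in> dual_ball"
  shows "blinfun_apply (Blinfun k) = k" "norm (Blinfun k) \<le> 1"
proof -
  have "bounded_linear k"
    using assms unfolding dual_ball_def
    by (auto intro!: bounded_linear_intro[where K = 1] simp: linear_add linear_scale)
  then show *: "blinfun_apply (Blinfun k) = k" by (rule bounded_linear_Blinfun_apply)
  show "norm (Blinfun k) \<le> 1"
    by (rule norm_blinfun_bound) (use assms in \<open>auto simp: * dual_ball_def\<close>)
qed

lemma blinfun_in_dual_ball: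
  assumes "norm j \<le> 1"
  shows "blinfun_apply j \<in> dual_ball"
proof -
  have "\<bar>blinfun_apply j x\<bar> \<le> norm x" for x
    using norm_blinfun[of j x] mult_right_mono[OF assms norm_ge_zero[of x]] by simp
  then show ?thesis
    by (simp add: dual_ball_def bounded_linear.linear[OF blinfun.bounded_linear_right])
qed

text \<open>\<open>K\<close> may reach outside the ball; thus the whole function space qualifies and
  serves as the starting point of the minimisation.\<close>

definition meets_duality_map :: "'a::real_normed_vector set \<Rightarrow> ('a \<Rightarrow> real) set \<Rightarrow> bool" where
  "meets_duality_map A K \<longleftrightarrow> (\<forall>x\<in>A. \<exists>k\<in>K \<inter> dual_ball. k x = norm x)"

text \<open>Zorn's lemma for complements, which turns minimal into maximal. Along a chain the
  duality property survives because the norming functionals of \<open>x\<close> form a compact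
  subset of the ball, so the finite intersection property applies.\<close>

lemma minimal_closed_meets_duality_map:
  fixes A :: "'a::real_normed_vector set"
  shows "\<exists>K. closed K \<and> meets_duality_map A K \<and>
    (\<forall>K'. closed K' \<longrightarrow> meets_duality_map A K' \<longrightarrow> K' \<subseteq> K \<longrightarrow> K' = K)"
proof -
  define \<A> where "\<A> = {M. closed (- M) \<and> meets_duality_map A (- M)}"
  have "{} \<in> \<A>"
    unfolding \<A>_def meets_duality_map_def
    using norming_functional blinfun_in_dual_ball by fastforce
  then have "\<A> \<noteq> {}" by blast
  moreover have "\<Union>\<C> \<in> \<A>" if ne: "\<C> \<noteq> {}" and ch: "subset.chain \<A> \<C>" for \<C>
  proof -
    have sub: "closed (- M)" "meets_duality_map A (- M)" if "M \<in> \<C>" for M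
      using ch that by (auto simp: subset_chain_def \<A>_def)
    have "closed (- \<Union>\<C>)" using sub(1) by (auto simp: closed_def)
    moreover have "\<exists>k\<in>(- \<Union>\<C>) \<inter> dual_ball. k x = norm x" if x: "x \<in> A" for x
    proof -
      have "compact ({k. k x = norm x} \<inter> dual_ball)"
        by (intro closed_Int_compact closed_evaluation_eq compact_dual_ball)
      then have "({k. k x = norm x} \<inter> dual_ball) \<inter> \<Inter>(uminus ` \<C>) \<noteq> {}"
      proof (rule compact_imp_fip)
        show "closed T" if "T \<in> uminus ` \<C>" for T using that sub by auto
        fix F' assume "finite F'" "F' \<subseteq> uminus ` \<C>"
        then obtain \<B> where \<B>: "\<B> \<subseteq> \<C>" "finite \<B>" "F' = uminus ` \<B>"
          by (auto dest: finite_subset_image)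
        have "\<exists>M\<in>\<C>. \<Union>\<B> \<subseteq> M"
        proof (cases "\<B> = {}")
          case False
          have tot: "X \<subseteq> Y \<or> Y \<subseteq> X" if "X \<in> \<C>" "Y \<in> \<C>" for X Y
            using ch that by (simp add: subset_chain_def)
          have "subset.chain \<A> \<B>"
            unfolding subset_chain_def
          proof (intro conjI ballI)
            show "\<B> \<subseteq> \<A>" using ch subset_trans[OF \<B>(1)] by (simp add: subset_chain_def)
            show "X \<subseteq> Y \<or> Y \<subseteq> X" if "X \<in> \<B>" "Y \<in> \<B>" for X Y
              using tot subsetD[OF \<B>(1)] that by simp
          qed
          then have "\<Union>\<B> \<in> \<C>" using Union_in_chain[OF \<B>(2) False] \<B>(1) by (simp add: subsetD)
          then show ?thesis by (intro bexI[of _ "\<Union>\<B>"]) simp_all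
        qed (use ne in auto)
        then obtain M where M: "M \<in> \<C>" "\<Union>\<B> \<subseteq> M" by (elim bexE)
        obtain k where k: "k \<in> - M \<inter> dual_ball" "k x = norm x"
          using sub(2)[OF M(1), unfolded meets_duality_map_def, rule_format, OF x] by (elim bexE)
        have "k \<in> \<Inter>F'"
        proof
          fix T assume "T \<in> F'"
          then obtain N where N: "N \<in> \<B>" "T = - N" unfolding \<B>(3) by (elim imageE)
          have "N \<subseteq> M" using order_trans[OF Union_upper[OF N(1)] M(2)] .
          from subsetD[OF this, of k] show "k \<in> T" using k(1) N(2) by auto
        qed
        then have "k \<in> ({k. k x = norm x} \<inter> dual_ball) \<inter> \<Inter>F'"
          using k by simp
        then show "({k. k x = norm x} \<inter> dual_ball) \<inter> \<Inter>F' \<noteq> {}" by blast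
      qed
      then show ?thesis by auto
    qed
    ultimately show ?thesis by (simp add: \<A>_def meets_duality_map_def)
  qed
  ultimately obtain M where M: "M \<in> \<A>" and max: "\<And>M'. M' \<in> \<A> \<Longrightarrow> M \<subseteq> M' \<Longrightarrow> M' = M"
    using subset_Zorn_nonempty[of \<A>] by blast
  have "K' = - M" if "closed K'" "meets_duality_map A K'" "K' \<subseteq> - M" for K'
    using max[of "- K'"] that by (auto simp: \<A>_def)
  then show ?thesis using M unfolding \<A>_def by (intro exI[of _ "- M"]) blast
qed

text \<open>Smulian: the slice is centred at the Frechet derivative of the support function of \<open>K\<close>.\<close>

lemma Asplund_small_slice:
  fixes K :: "('a::banach \<Rightarrow> real) set"
  assumes asplund: "asplund_space TYPE('a)" and K: "K \<noteq> {}" "K \<subseteq> dual_ball" and e: "e > 0"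
  shows "\<exists>u s (\<xi> :: 'a \<Rightarrow>\<^sub>L real). (\<exists>k\<in>K. k u > s) \<and>
    (\<forall>k\<in>K. k u > s \<longrightarrow> (\<forall>h. \<bar>k h - blinfun_apply \<xi> h\<bar> \<le> e * norm h))"
proof -
  define \<phi> where "\<phi> u = (SUP k\<in>K. k u)" for u
  have lin: "linear k" and kle: "\<bar>k x\<bar> \<le> norm x" if "k \<in> K" for k x
    using K that by (auto simp: dual_ball_def)
  have bdd: "bdd_above ((\<lambda>k. k u) ` K)" for u
    using kle by (intro bdd_aboveI2[of _ _ "norm u"]) (auto simp: abs_le_iff)
  have upper: "k u \<le> \<phi> u" if "k \<in> K" for k u
    unfolding \<phi>_def by (rule cSUP_upper[OF that bdd])
  have least: "\<phi> u \<le> c" if "\<And>k. k \<in> K \<Longrightarrow> k u \<le> c" for u c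
    unfolding \<phi>_def by (rule cSUP_least) (use K that in auto)
  have "convex_on UNIV \<phi>"
  proof (rule convex_onI)
    fix t :: real and x y :: 'a assume t: "0 < t" "t < 1"
    show "\<phi> ((1 - t) *\<^sub>R x + t *\<^sub>R y) \<le> (1 - t) * \<phi> x + t * \<phi> y"
    proof (rule least)
      fix k assume k: "k \<in> K"
      have "k ((1 - t) *\<^sub>R x + t *\<^sub>R y) = (1 - t) * k x + t * k y"
        using lin[OF k] by (simp add: linear_add linear_scale)
      also have "\<dots> \<le> (1 - t) * \<phi> x + t * \<phi> y"
        using upper[OF k] t by (intro add_mono mult_left_mono) auto
      finally show "k ((1 - t) *\<^sub>R x + t *\<^sub>R y) \<le> (1 - t) * \<phi> x + t * \<phi> y" .
    qed
  qed auto
  moreover have "continuous_on UNIV \<phi>"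
  proof -
    have le: "\<phi> u \<le> \<phi> v + dist u v" for u v
    proof (rule least)
      fix k assume k: "k \<in> K"
      show "k u \<le> \<phi> v + dist u v"
        using kle[OF k, of "u - v"] upper[OF k, of v] linear_diff[OF lin[OF k], of u v]
        by (simp add: dist_norm)
    qed
    have "dist (\<phi> u) (\<phi> v) \<le> dist u v" for u v
      using le[of u v] le[of v u] by (simp add: dist_real_def dist_commute abs_le_iff)
    then show ?thesis
      unfolding continuous_on_iff by (meson order_le_less_trans)
  qed
  ultimately obtain u where "\<phi> differentiable (at u)"
    using asplund unfolding asplund_space_def by blast
  then obtain D where D: "bounded_linear D"
    and "\<And>e. e > 0 \<Longrightarrow> \<exists>d>0. \<forall>y. norm (y - u) < d \<longrightarrow> norm (\<phi> y - \<phi> u - D (y - u)) \<le> e * norm (y - u)"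
    unfolding differentiable_def has_derivative_at_alt by blast
  then obtain d where d: "d > 0"
    "\<And>y. norm (y - u) < d \<Longrightarrow> norm (\<phi> y - \<phi> u - D (y - u)) \<le> (e/2) * norm (y - u)"
    using e by (metis half_gt_zero)
  note Dlin = bounded_linear.linear[OF D]
  define r where "r = d / 2"
  \<comment> \<open>The depth of the slice and the differentiability estimate each cost
    \<open>(e/2) * r\<close>. Scaling \<open>h\<close> to length \<open>r = d / 2\<close> stays
    within the radius \<open>d\<close> and gives the total error \<open>e * r\<close>.\<close>
  define s where "s = \<phi> u - (e/2) * r"
  have r: "r > 0" using d by (simp add: r_def)
  have "s < \<phi> u" using e r by (simp add: s_def)
  then have "\<exists>k\<in>K. k u > s"
    unfolding \<phi>_def by (subst (asm) less_cSUP_iff) (use K bdd in auto)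
  moreover have "\<bar>k h - D h\<bar> \<le> e * norm h" if k: "k \<in> K" "k u > s" for k h
  proof (cases "h = 0")
    case True
    then show ?thesis using lin[OF k(1)] Dlin by (simp add: linear_0)
  next
    case False
    have *: "k h - D h \<le> e * norm h" if "h \<noteq> 0" for h
    proof -
      define c where "c = r / norm h"
      have c: "c > 0" "c * norm h = r" using r that by (auto simp: c_def)
      have "norm (u + c *\<^sub>R h - u) < d" using c d r by (simp add: r_def)
      from d(2)[OF this] have "\<bar>\<phi> (u + c *\<^sub>R h) - \<phi> u - c * D h\<bar> \<le> (e/2) * r"
        using c Dlin by (simp add: linear_scale)
      then have "\<phi> (u + c *\<^sub>R h) \<le> \<phi> u + c * D h + (e/2) * r" by linarith
      moreover have "k u + c * k h \<le> \<phi> (u + c *\<^sub>R h)"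
        using upper[OF k(1), of "u + c *\<^sub>R h"] lin[OF k(1)] by (simp add: linear_add linear_scale)
      ultimately have "c * (k h - D h) \<le> e * r"
        using k(2) by (simp add: s_def algebra_simps)
      also have "\<dots> = c * (e * norm h)" using c by simp
      finally show ?thesis using c by simp
    qed
    from *[OF False] *[of "- h"] False show ?thesis
      using lin[OF k(1)] Dlin by (simp add: linear_neg abs_le_iff)
  qed
  ultimately show ?thesis
    using bounded_linear_Blinfun_apply[OF D] by (intro exI[of _ u] exI[of _ s] exI[of _ "Blinfun D"]) auto
qed

text \<open>Cut a small slice off a minimal closed set \<open>K\<close> meeting the duality map over
  \<open>A\<close>. By minimality the rest fails at some \<open>x0\<close> in \<open>A\<close>, and
  by compactness it fails with a gap. Near \<open>x0\<close> the norming functionals taken from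
  \<open>K\<close> therefore lie in the slice, close to \<open>\<xi>\<close>.\<close>

lemma Asplund_local_selection:
  fixes A :: "'a::banach set"
  assumes asplund: "asplund_space TYPE('a)" and A: "A \<noteq> {}" and e: "e > 0"
  shows "\<exists>U \<xi>. open U \<and> U \<inter> A \<noteq> {} \<and>
    (\<forall>x\<in>U \<inter> A. \<exists>j :: 'a \<Rightarrow>\<^sub>L real. norm j \<le> 1 \<and> blinfun_apply j x = norm x \<and> norm (j - \<xi>) \<le> e)"
proof -
  obtain K where K: "closed K" "meets_duality_map A K"
    and min: "\<And>K'. closed K' \<Longrightarrow> meets_duality_map A K' \<Longrightarrow> K' \<subseteq> K \<Longrightarrow> K' = K"
    using minimal_closed_meets_duality_map[of A] by blast
  have "K \<inter> dual_ball \<noteq> {}" using A K(2) unfolding meets_duality_map_def by blast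
  then obtain u s and \<xi> :: "'a \<Rightarrow>\<^sub>L real" where slice: "\<exists>k\<in>K \<inter> dual_ball. k u > s"
    and small: "\<forall>k\<in>K \<inter> dual_ball. k u > s \<longrightarrow> (\<forall>h. \<bar>k h - \<xi> h\<bar> \<le> e * norm h)"
    using Asplund_small_slice[OF asplund _ Int_lower2 e, of K] by blast
  define K' where "K' = K \<inter> {k. k u \<le> s}"
  have clK': "closed K'" unfolding K'_def by (intro closed_Int K closed_evaluation_le)
  have "K' \<subseteq> K" "K' \<noteq> K" using slice unfolding K'_def by force+
  then have "\<not> meets_duality_map A K'" using min clK' by blast
  then obtain x0 where x0: "x0 \<in> A" "\<And>k. k \<in> K' \<inter> dual_ball \<Longrightarrow> k x0 \<noteq> norm x0"
    unfolding meets_duality_map_def by blast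
  have "\<exists>t<norm x0. \<forall>k\<in>K' \<inter> dual_ball. k x0 \<le> t"
  proof (cases "K' \<inter> dual_ball = {}")
    case True
    then show ?thesis by (auto intro: exI[of _ "norm x0 - 1"])
  next
    case False
    have "compact (K' \<inter> dual_ball)" by (intro closed_Int_compact clK' compact_dual_ball)
    from continuous_attains_sup[OF this False continuous_evaluation, of x0]
    obtain k where k: "k \<in> K' \<inter> dual_ball" "\<forall>k'\<in>K' \<inter> dual_ball. k' x0 \<le> k x0" by blast
    have "k x0 \<le> norm x0" using k(1) by (auto simp: dual_ball_def abs_le_iff)
    then show ?thesis using k x0(2)[OF k(1)] by (intro exI[of _ "k x0"]) auto
  qed
  then obtain t where t: "t < norm x0" "\<And>k. k \<in> K' \<inter> dual_ball \<Longrightarrow> k x0 \<le> t" by blast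
  \<comment> \<open>Moving from \<open>x0\<close> to \<open>x\<close> changes both
    \<open>k x0\<close> and \<open>norm x0\<close> by at most \<open>norm (x - x0)\<close>, so half
    of the gap is a safe radius.\<close>
  define U where "U = ball x0 ((norm x0 - t) / 2)"
  have "\<exists>j :: 'a \<Rightarrow>\<^sub>L real. norm j \<le> 1 \<and> blinfun_apply j x = norm x \<and> norm (j - \<xi>) \<le> e"
    if x: "x \<in> U \<inter> A" for x
  proof -
    obtain k where k: "k \<in> K \<inter> dual_ball" "k x = norm x"
      using K(2) x unfolding meets_duality_map_def by blast
    have "k \<notin> K'"
    proof
      assume "k \<in> K'"
      then have "k x0 \<le> t" using k t by blast
      moreover have "k x - k x0 \<le> norm (x - x0)"
      proof -
        have "k (x - x0) = k x - k x0" using k(1) by (simp add: dual_ball_def linear_diff)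
        then show ?thesis using k(1) by (auto simp: dual_ball_def abs_le_iff dest!: spec[of _ "x - x0"])
      qed
      moreover have "norm x0 - norm x \<le> norm (x - x0)" by (metis norm_minus_commute norm_triangle_ineq2)
      moreover have "2 * norm (x - x0) < norm x0 - t"
        using x by (simp add: U_def dist_norm norm_minus_commute)
      ultimately show False using k(2) by linarith
    qed
    then have "k u > s" using k by (auto simp: K'_def)
    then have *: "\<bar>k h - \<xi> h\<bar> \<le> e * norm h" for h using small k by blast
    have "norm (Blinfun k - \<xi>) \<le> e"
      by (rule norm_blinfun_bound)
        (use e * k(1) in \<open>auto simp: blinfun.diff_left dual_ball_Blinfun(1)\<close>)
    then show ?thesis
      using dual_ball_Blinfun[of k] k by (intro exI[of _ "Blinfun k"]) auto
  qed
  moreover have "x0 \<in> U \<inter> A" using x0 t by (simp add: U_def)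
  then have "U \<inter> A \<noteq> {}" by blast
  moreover have "open U" by (simp add: U_def)
  ultimately show ?thesis by blast
qed

section \<open>Exhaustion and separability\<close>

text \<open>Exhaustion: a transfinite sequence of open sets \<open>U s\<close>, each enlarging the union of its
  predecessors, must cover the space, since its index set \<open>'a set\<close> is too large to inject into \<open>'a\<close>.
  The layers \<open>U s - (\<Union>t<s. U t)\<close> are then separated by shrinking, as in Stone's theorem.\<close>

lemma locally_constant_selection:
  fixes Q :: "'a::metric_space \<Rightarrow> 'b \<Rightarrow> bool"
  assumes loc: "\<And>A. A \<noteq> {} \<Longrightarrow> \<exists>U \<xi>. open U \<and> U \<inter> A \<noteq> {} \<and> (\<forall>x\<in>U \<inter> A. Q x \<xi>)"
  shows "\<exists>g :: 'a \<Rightarrow> 'b set. (\<forall>x. countable (g x)) \<and> (\<forall>\<xi>. open {x. \<xi> \<in> g x}) \<and> (\<forall>x. \<exists>\<xi>\<in>g x. Q x \<xi>)"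
proof -
  obtain r :: "('a set) rel" where r: "Well_order r" "Field r = UNIV"
    using well_ordering by (elim exE conjE)
  define R where "R = r - Id"
  have wf: "wf R" using r by (simp add: R_def well_order_on_def)
  have total: "(s, t) \<in> R \<or> s = t \<or> (t, s) \<in> R" for s t
    using r by (auto simp: R_def well_order_on_def linear_order_on_def total_on_def)
  \<comment> \<open>\<open>F s\<close> pairs an open set with its selected value. If the
    predecessors already cover the space, no new point is demanded and the empty set continues the
    recursion.\<close>
  define P where "P F s p \<longleftrightarrow> (let W = (\<Union>t\<in>{t. (t, s) \<in> R}. fst (F t)) in open (fst p) \<and>
      (W \<noteq> UNIV \<longrightarrow> \<not> fst p \<subseteq> W) \<and> (\<forall>x\<in>fst p - W. Q x (snd p)))"
    for F :: "'a set \<Rightarrow> 'a set \<times> 'b" and s p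
  have "\<exists>F. \<forall>s. P F s (F s)"
  proof (rule dependent_wf_choice[OF wf])
    show "P F s p = P G s p" if "\<And>t. (t, s) \<in> R \<Longrightarrow> F t = G t" for F G s p
      using that unfolding P_def Let_def by simp
    show "\<exists>p. P F s p" for s F
    proof (cases "(\<Union>t\<in>{t. (t, s) \<in> R}. fst (F t)) = UNIV")
      case True
      then show ?thesis by (intro exI[of _ "({}, undefined)"]) (auto simp: P_def)
    next
      case False
      define W where "W = (\<Union>t\<in>{t. (t, s) \<in> R}. fst (F t))"
      have "- W \<noteq> {}" using False unfolding W_def[symmetric] by auto
      from loc[OF this] obtain U \<xi> where "open U" "U \<inter> - W \<noteq> {}" "\<forall>x\<in>U \<inter> - W. Q x \<xi>"
        by (elim exE conjE)
      then show ?thesis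
        unfolding P_def Let_def W_def[symmetric] by (intro exI[of _ "(U, \<xi>)"]) auto
    qed
  qed
  then obtain F where F: "\<And>s. P F s (F s)" by blast
  define U where "U s = fst (F s)" for s
  define \<xi> where "\<xi> s = snd (F s)" for s
  define W where "W s = (\<Union>t\<in>{t. (t, s) \<in> R}. U t)" for s
  have U: "open (U s)" "W s \<noteq> UNIV \<Longrightarrow> \<not> U s \<subseteq> W s" "\<And>x. x \<in> U s - W s \<Longrightarrow> Q x (\<xi> s)" for s
    using F[of s] unfolding P_def Let_def U_def W_def \<xi>_def by auto
  have UW: "U s \<subseteq> W t" if "(s, t) \<in> R" for s t
    using that by (auto simp: W_def)
  have cover: "\<exists>s. x \<in> U s" for x
  proof (rule ccontr)
    assume x: "\<not> (\<exists>s. x \<in> U s)"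
    then have "x \<notin> W s" for s by (auto simp: W_def)
    then have "\<exists>p. p \<in> U s - W s" for s using U(2)[of s] by blast
    then obtain p where p: "\<And>s. p s \<in> U s - W s" by metis
    \<comment> \<open>\<open>p s\<close> is a point new at stage \<open>s\<close>. An uncovered
      \<open>x\<close> would provide one at every stage, and hence an injection of
      \<open>'a set\<close> into \<open>'a\<close>, against Cantor's theorem.\<close>
    have "inj p"
    proof (rule injI, rule ccontr)
      fix s t assume "p s = p t" "s \<noteq> t"
      then show False using total[of s t] UW[of s t] UW[of t s] p[of s] p[of t] by auto
    qed
    then have "inv p ` UNIV = Pow UNIV" by (simp add: inj_imp_surj_inv)
    moreover have "\<nexists>f. f ` (UNIV :: 'a set) = Pow (UNIV :: 'a set)" by (rule Cantors_theorem)
    ultimately show False by (elim notE exI)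
  qed
  have layer: "\<exists>s. x \<in> U s - W s" for x
  proof -
    obtain s0 where "x \<in> U s0" using cover by blast
    then have "s0 \<in> {s. x \<in> U s}" by simp
    from wfE_min[OF wf this] obtain s where "s \<in> {s. x \<in> U s}"
      "\<And>t. (t, s) \<in> R \<Longrightarrow> t \<notin> {s. x \<in> U s}" by metis
    then show ?thesis by (intro exI[of _ s]) (simp add: W_def)
  qed
  \<comment> \<open>The points of the layer whose ball of radius \<open>1 / real (Suc n)\<close>
    stays in \<open>U s\<close> are thickened by half that radius. For fixed \<open>n\<close>, two
    thickened layers that meet would put a centre of the later one into the earlier
    \<open>U s\<close>.\<close>
  define E where "E n s = (\<Union>x\<in>{x \<in> U s - W s. ball x (1 / real (Suc n)) \<subseteq> U s}. ball x (1 / (2 * real (Suc n))))"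
    for n s
  have opE: "open (E n s)" for n s by (auto simp: E_def)
  have disj': False if st: "(s, t) \<in> R" and z: "z \<in> E n s" "z \<in> E n t" for n s t z
  proof -
    obtain x y where xy: "ball x (1 / real (Suc n)) \<subseteq> U s" "y \<in> U t - W t"
      "dist x z < 1 / (2 * real (Suc n))" "dist y z < 1 / (2 * real (Suc n))"
      using z by (auto simp: E_def)
    have "dist x y \<le> dist x z + dist y z" by (rule dist_triangle2)
    also have "\<dots> < 1 / real (Suc n)" using xy(3,4) by (simp add: field_simps)
    finally have "y \<in> U s" using xy(1) by auto
    then show False using UW[OF st] xy(2) by blast
  qed
  then have disj: "s = t" if "z \<in> E n s" "z \<in> E n t" for n s t z
    using total[of s t] that by blast
  have inE: "\<exists>n. x \<in> E n s" if x: "x \<in> U s - W s" for x s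
  proof -
    obtain e where "e > 0" "ball x e \<subseteq> U s" using U(1) x open_contains_ball by blast
    moreover from this(1) obtain n where "1 / real (Suc n) < e"
      using nat_approx_posE by blast
    ultimately have "ball x (1 / real (Suc n)) \<subseteq> U s"
      by (meson less_imp_le order_trans subset_ball)
    then have "x \<in> E n s" using x unfolding E_def by (intro UN_I[of x]) auto
    then show ?thesis by blast
  qed
  define g where "g x = (\<Union>n. \<xi> ` {s. x \<in> E n s})" for x
  have "countable (g x)" for x
    unfolding g_def
  proof (intro countable_UN countable_image)
    show "countable {s. x \<in> E n s}" for n
    proof (cases "\<exists>s. x \<in> E n s")
      case True
      then obtain s where "x \<in> E n s" by blast
      then have "{s. x \<in> E n s} = {s}" using disj by blast
      then show ?thesis by simp
    qed auto
  qed auto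
  moreover have "open {x. \<eta> \<in> g x}" for \<eta>
  proof -
    have "{x. \<eta> \<in> g x} = (\<Union>n. \<Union>s\<in>{s. \<xi> s = \<eta>}. E n s)" by (auto simp: g_def)
    then show ?thesis by (simp only:) (intro open_UN ballI opE)
  qed
  moreover have "\<exists>\<eta>\<in>g x. Q x \<eta>" for x
  proof -
    obtain s where s: "x \<in> U s - W s" using layer by blast
    then obtain n where "x \<in> E n s" using inE by blast
    then have "\<xi> s \<in> g x" by (auto simp: g_def)
    then show ?thesis using U(3)[OF s] by blast
  qed
  ultimately show ?thesis by blast
qed

section \<open>Subspaces, closures and countable dense sets\<close>

lemma subspace_closure:
  fixes S :: "'a::real_normed_vector set"
  assumes "subspace S"
  shows "subspace (closure S)"
  unfolding subspace_def
proof (intro conjI ballI allI)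
  show "0 \<in> closure S" using subspace_0[OF assms] closure_subset by blast
  show "x + y \<in> closure S" if xy: "x \<in> closure S" "y \<in> closure S" for x y
  proof -
    obtain a b where ab: "\<And>n. a n \<in> S" "a \<longlonglongrightarrow> x" "\<And>n. b n \<in> S" "b \<longlonglongrightarrow> y"
      using xy unfolding closure_sequential by blast
    then show ?thesis
      unfolding closure_sequential
      by (intro exI[of _ "\<lambda>n. a n + b n"] conjI allI tendsto_add subspace_add[OF assms])
  qed
  show "c *\<^sub>R x \<in> closure S" if x: "x \<in> closure S" for c x
  proof -
    obtain a where a: "\<And>n. a n \<in> S" "a \<longlonglongrightarrow> x"
      using x unfolding closure_sequential by blast
    then show ?thesis
      unfolding closure_sequential
      by (intro exI[of _ "\<lambda>n. c *\<^sub>R a n"] conjI allI tendsto_scaleR tendsto_const subspace_scale[OF assms])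
  qed
qed

lemma subspace_UN_incseq:
  assumes "incseq S" "\<And>n. subspace (S n)"
  shows "subspace (\<Union>n::nat. S n)"
  unfolding subspace_def
proof (intro conjI ballI allI)
  show "0 \<in> (\<Union>n. S n)" using subspace_0[OF assms(2)] by blast
  show "x + y \<in> (\<Union>n. S n)" if xy: "x \<in> (\<Union>n. S n)" "y \<in> (\<Union>n. S n)" for x y
  proof -
    obtain m n where mn: "x \<in> S m" "y \<in> S n" using xy by blast
    have "S m \<subseteq> S (max m n)" "S n \<subseteq> S (max m n)" using assms(1) by (simp_all add: incseqD)
    then have "x + y \<in> S (max m n)" using mn by (intro subspace_add[OF assms(2)]) auto
    then show ?thesis by blast
  qed
  show "c *\<^sub>R x \<in> (\<Union>n. S n)" if x: "x \<in> (\<Union>n. S n)" for c x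
    using x subspace_scale[OF assms(2)] by blast
qed

text \<open>Close \<open>insert 0 G\<close> under the operations
  \<open>of_rat q *\<^sub>R x + y\<close>. Density of the rationals makes the closure of the
  resulting countable set a subspace.\<close>

lemma countable_dense_span:
  fixes G :: "'a::real_normed_vector set"
  assumes "countable G"
  shows "\<exists>D. countable D \<and> closure D = closure (span G)"
proof -
  define step where "step D = (\<lambda>(q, x, y). of_rat q *\<^sub>R x + y) ` (UNIV \<times> D \<times> D)" for D :: "'a set"
  define S where "S n = (step ^^ n) (insert 0 G)" for n
  define D where "D = (\<Union>n. S n)"
  have S0: "S 0 = insert 0 G" and SS: "S (Suc n) = step (S n)" for n by (simp_all add: S_def)
  have cS: "countable (S n)" for n
    by (induction n) (auto simp: S0 SS step_def assms intro!: countable_image countable_SIGMA)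
  have zS: "0 \<in> S n" for n
  proof (induction n)
    case (Suc n)
    then show ?case unfolding SS step_def by (intro image_eqI[of _ _ "(0, 0, 0)"]) auto
  qed (simp add: S0)
  have "S n \<subseteq> S (Suc n)" for n
    unfolding SS step_def using zS[of n] by (auto intro!: image_eqI[of _ _ "(0, 0, _)"])
  then have mono: "S m \<subseteq> S n" if "m \<le> n" for m n using lift_Suc_mono_le that by blast
  have lin: "of_rat q *\<^sub>R x + y \<in> D" if xy: "x \<in> D" "y \<in> D" for q x y
  proof -
    obtain m n where "x \<in> S m" "y \<in> S n" using xy by (auto simp: D_def)
    then have "x \<in> S (max m n)" "y \<in> S (max m n)" using mono by (meson max.cobounded1 max.cobounded2 subsetD)+
    then have "of_rat q *\<^sub>R x + y \<in> S (Suc (max m n))"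
      unfolding SS step_def by (intro image_eqI[of _ _ "(q, x, y)"]) auto
    then show ?thesis by (auto simp: D_def)
  qed
  have "subspace (closure D)"
    unfolding subspace_def
  proof (intro conjI ballI allI)
    show "0 \<in> closure D" using zS by (intro subsetD[OF closure_subset]) (auto simp: D_def)
    show "x + y \<in> closure D" if xy: "x \<in> closure D" "y \<in> closure D" for x y
    proof -
      obtain a b where ab: "\<And>n. a n \<in> D" "a \<longlonglongrightarrow> x" "\<And>n. b n \<in> D" "b \<longlonglongrightarrow> y"
        using xy unfolding closure_sequential by blast
      have "a n + b n \<in> D" for n using lin[OF ab(1,3), of 1] by simp
      then show ?thesis
        unfolding closure_sequential
        by (intro exI[of _ "\<lambda>n. a n + b n"] conjI allI tendsto_add ab(2,4))
    qed
    show "c *\<^sub>R x \<in> closure D" if x: "x \<in> closure D" for c x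
    proof -
      obtain a where a: "\<And>n. a n \<in> D" "a \<longlonglongrightarrow> x"
        using x unfolding closure_sequential by blast
      have "c \<in> closure \<rat>" by (simp add: Rats_closure_real)
      then obtain b where b: "\<And>n. b n \<in> \<rat>" "b \<longlonglongrightarrow> c"
        unfolding closure_sequential by blast
      have "b n *\<^sub>R a n \<in> D" for n
      proof -
        obtain q where "b n = of_rat q" using b(1)[of n] by (auto elim: Rats_cases)
        then show ?thesis using lin[OF a(1), of 0 q] zS by (auto simp: D_def)
      qed
      then show ?thesis
        unfolding closure_sequential
        by (intro exI[of _ "\<lambda>n. b n *\<^sub>R a n"] conjI allI tendsto_scaleR b(2) a(2))
    qed
  qed
  moreover have "G \<subseteq> closure D"
    using closure_subset[of D] S0 by (auto simp: D_def)
  ultimately have "span G \<subseteq> closure D" by (rule span_minimal[rotated])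
  moreover have "S n \<subseteq> span G" for n
    by (induction n)
      (auto simp: S0 SS step_def span_zero span_base intro!: span_add span_scale)
  then have "D \<subseteq> span G" by (auto simp: D_def)
  ultimately have "closure D = closure (span G)"
    by (metis closure_closure closure_mono subset_antisym)
  then show ?thesis using cS by (intro exI[of _ D]) (auto simp: D_def)
qed

section \<open>Separable reduction\<close>

text \<open>\<open>W\<close> detects the whole norm of every \<open>y \<in> Y\<close>. Thresholds
  replace the supremum, so that each requirement asks for a single point of
  \<open>W\<close>.\<close>

definition norming :: "('a::real_normed_vector \<Rightarrow>\<^sub>L real) set \<Rightarrow> 'a set \<Rightarrow> bool" where
  "norming Y W \<longleftrightarrow> (\<forall>y\<in>Y. \<forall>c. (\<exists>x. c * norm x < \<bar>blinfun_apply y x\<bar>) \<longrightarrow> (\<exists>x\<in>W. c * norm x < \<bar>blinfun_apply y x\<bar>))"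

text \<open>Annuli rather than balls around \<open>v\<close>: their centre can be approximated without any continuity
  of \<open>f\<close>, and they keep the solutions away from \<open>v\<close>.\<close>

definition annular_sublevel :: "('a::real_normed_vector \<Rightarrow> ereal) \<Rightarrow> 'a \<Rightarrow> ('a \<Rightarrow>\<^sub>L real) \<Rightarrow> real \<Rightarrow> real \<Rightarrow> real \<Rightarrow> 'a set" where
  "annular_sublevel f v y a b c = {x. a < norm (x - v) \<and> norm (x - v) < b \<and> f x < ereal (c + blinfun_apply y x)}"

text \<open>\<open>W\<close> is kept separate from \<open>V\<close> so that witnesses can first be
  collected outside \<open>V\<close>; iteration makes the two coincide in the limit.\<close>

definition witnessed :: "('a::real_normed_vector \<Rightarrow> ereal) \<Rightarrow> 'a set \<Rightarrow> ('a \<Rightarrow>\<^sub>L real) set \<Rightarrow> 'a set \<Rightarrow> bool" where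
  "witnessed f V Y W \<longleftrightarrow> (\<forall>v\<in>V. \<forall>y\<in>Y. \<forall>a b c. annular_sublevel f v y a b c \<noteq> {} \<longrightarrow> annular_sublevel f v y a b c \<inter> W \<noteq> {})"

lemma norming_mono: "norming Y W \<Longrightarrow> Y' \<subseteq> Y \<Longrightarrow> W \<subseteq> W' \<Longrightarrow> norming Y' W'"
  unfolding norming_def by (meson subsetD)

lemma witnessed_mono: "witnessed f V Y W \<Longrightarrow> V' \<subseteq> V \<Longrightarrow> Y' \<subseteq> Y \<Longrightarrow> W \<subseteq> W' \<Longrightarrow> witnessed f V' Y' W'"
  unfolding witnessed_def by blast

lemma norming_norm_le:
  assumes "norming Y W" "y \<in> Y" "0 \<le> c" "\<And>w. w \<in> W \<Longrightarrow> \<bar>blinfun_apply y w\<bar> \<le> c * norm w"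
  shows "norm y \<le> c"
proof (rule norm_blinfun_bound[OF assms(3)])
  fix x
  have "\<not> (\<exists>x. c * norm x < \<bar>blinfun_apply y x\<bar>)"
    using assms(1,2,4) unfolding norming_def by (meson not_le)
  then show "norm (blinfun_apply y x) \<le> c * norm x" by (simp add: not_less)
qed

lemma blinfun_diff_le: "\<bar>blinfun_apply y x - blinfun_apply z x\<bar> \<le> dist y z * norm x"
  for y z :: "'a::real_normed_vector \<Rightarrow>\<^sub>L real"
  using norm_blinfun[of "y - z" x] by (simp add: blinfun.diff_left dist_norm)

text \<open>A rational threshold strictly between \<open>c\<close> and the quotient attained at
  \<open>x\<close> leaves room on both sides: for passing from \<open>y\<close> to a nearby
  \<open>y'\<close> in \<open>D\<close>, and for carrying the witness back to
  \<open>y\<close>.\<close>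

lemma norming_closure:
  assumes D: "\<And>y q. y \<in> D \<Longrightarrow> q \<in> \<rat> \<Longrightarrow> \<exists>x. q * norm x < \<bar>blinfun_apply y x\<bar> \<Longrightarrow>
      \<exists>x\<in>W. q * norm x < \<bar>blinfun_apply y x\<bar>"
  shows "norming (closure D) W"
  unfolding norming_def
proof (intro ballI allI impI)
  fix y c assume y: "y \<in> closure D" and "\<exists>x. c * norm x < \<bar>blinfun_apply y x\<bar>"
  then obtain x where x: "c * norm x < \<bar>blinfun_apply y x\<bar>" by blast
  then have nx: "norm x > 0" by (auto simp: blinfun.zero_right)
  define t where "t = \<bar>blinfun_apply y x\<bar> / norm x"
  have t: "\<bar>blinfun_apply y x\<bar> = t * norm x" "c < t" using x nx by (simp_all add: t_def field_simps)
  obtain q where q: "q \<in> \<rat>" "c < q" "q < t" using Rats_dense_in_real[OF t(2)] by blast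
  obtain y' where y': "y' \<in> D" "dist y' y < min (q - c) (t - q)"
    using y q unfolding closure_approachable by (metis diff_gt_0_iff_gt min_less_iff_conj)
  have "dist y' y * norm x < (t - q) * norm x" using y'(2) nx by simp
  then have "q * norm x < \<bar>blinfun_apply y' x\<bar>"
    using blinfun_diff_le[of y' x y] t(1) by (simp add: left_diff_distrib)
  then obtain w where w: "w \<in> W" "q * norm w < \<bar>blinfun_apply y' w\<bar>" using D[OF y'(1) q(1)] by blast
  have "dist y' y * norm w \<le> (q - c) * norm w" using y'(2) by (intro mult_right_mono) auto
  then have "c * norm w < \<bar>blinfun_apply y w\<bar>"
    using w(2) blinfun_diff_le[of y' w y] by (simp add: left_diff_distrib)
  then show "\<exists>x\<in>W. c * norm x < \<bar>blinfun_apply y x\<bar>" using w(1) by blast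
qed

text \<open>Shrink the annulus and lower the level to rational parameters, keeping the given
  solution \<open>x\<close>. A nearby centre in \<open>C\<close> and functional in \<open>D\<close>
  still admit \<open>x\<close>, and every witness for them solves the original problem.\<close>

lemma witnessed_closure:
  assumes CD: "\<And>v y a b c. v \<in> C \<Longrightarrow> y \<in> D \<Longrightarrow> a \<in> \<rat> \<Longrightarrow> b \<in> \<rat> \<Longrightarrow> c \<in> \<rat> \<Longrightarrow>
      annular_sublevel f v y a b c \<noteq> {} \<Longrightarrow> annular_sublevel f v y a b c \<inter> W \<noteq> {}"
  shows "witnessed f (closure C) (closure D) W"
  unfolding witnessed_def
proof (intro ballI allI impI)
  fix v y a b c assume v: "v \<in> closure C" and y: "y \<in> closure D" and "annular_sublevel f v y a b c \<noteq> {}"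
  then obtain x where x: "a < norm (x - v)" "norm (x - v) < b" "f x < ereal (c + blinfun_apply y x)"
    by (auto simp: annular_sublevel_def)
  obtain a' where a': "a' \<in> \<rat>" "a < a'" "a' < norm (x - v)" using Rats_dense_in_real[OF x(1)] by blast
  obtain b' where b': "b' \<in> \<rat>" "norm (x - v) < b'" "b' < b" using Rats_dense_in_real[OF x(2)] by blast
  obtain r where r: "f x < ereal r" "r < c + blinfun_apply y x"
    using ereal_dense2[OF x(3)] by auto
  then have "r - blinfun_apply y x < c" by simp
  then obtain c' where c': "c' \<in> \<rat>" "r - blinfun_apply y x < c'" "c' < c" using Rats_dense_in_real by blast
  \<comment> \<open>All points of the annulus around \<open>v\<close> have norm below
    \<open>M\<close>, so a functional within \<open>\<theta> / M\<close> of \<open>y\<close> differs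
    from it there by at most \<open>\<theta>\<close>.\<close>
  define M where "M = norm v + b"
  have "0 \<le> norm (x - v)" by simp
  then have "0 < b" using x(2) by linarith
  then have M: "M > 0" unfolding M_def by (simp add: add_nonneg_pos)
  have xM: "norm x < M" using x(2) norm_triangle_sub[of x v] by (simp add: M_def)
  \<comment> \<open>The inner margins admit \<open>x\<close> after the centre has moved; the outer
    ones bring the witness back into the original annulus.\<close>
  define \<eta> where "\<eta> = Min {a' - a, norm (x - v) - a', b' - norm (x - v), b - b'}"
  have \<eta>: "0 < \<eta>" "\<eta> \<le> a' - a" "\<eta> \<le> norm (x - v) - a'" "\<eta> \<le> b' - norm (x - v)" "\<eta> \<le> b - b'"
    using a' b' unfolding \<eta>_def by (auto simp: Min_gr_iff)
  define \<theta> where "\<theta> = min (c' + blinfun_apply y x - r) (c - c')"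
  have \<theta>: "0 < \<theta>" "\<theta> \<le> c' + blinfun_apply y x - r" "\<theta> \<le> c - c'" using c' by (auto simp: \<theta>_def)
  obtain v' where v': "v' \<in> C" "dist v' v < \<eta>" using v \<eta>(1) unfolding closure_approachable by blast
  have "0 < \<theta> / M" using \<theta> M by simp
  then obtain y' where y': "y' \<in> D" "dist y' y < \<theta> / M"
    using y unfolding closure_approachable by blast
  have yy: "\<bar>blinfun_apply y' u - blinfun_apply y u\<bar> \<le> \<theta>" if "norm u < M" for u
  proof -
    have "dist y' y * norm u \<le> (\<theta> / M) * M"
      using y'(2) that M \<theta>(1) by (intro mult_mono) auto
    then show ?thesis using blinfun_diff_le[of y' u y] M by simp
  qed
  have vv: "\<bar>norm (u - v') - norm (u - v)\<bar> < \<eta>" for u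
    using norm_triangle_ineq3[of "u - v'" "u - v"] v'(2) by (simp add: dist_norm norm_minus_commute)
  have "ereal r \<le> ereal (c' + blinfun_apply y' x)" using yy[OF xM] \<theta>(2) by simp
  then have "f x < ereal (c' + blinfun_apply y' x)" using r(1) by (rule less_le_trans[rotated])
  moreover have "a' < norm (x - v')" "norm (x - v') < b'" using vv[of x] \<eta> by linarith+
  ultimately have "x \<in> annular_sublevel f v' y' a' b' c'"
    by (simp add: annular_sublevel_def)
  then obtain w where w: "w \<in> W" "w \<in> annular_sublevel f v' y' a' b' c'"
    using CD[OF v'(1) y'(1) a'(1) b'(1) c'(1)] by blast
  then have w': "a' < norm (w - v')" "norm (w - v') < b'" "f w < ereal (c' + blinfun_apply y' w)"
    by (auto simp: annular_sublevel_def)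
  have ab: "a < norm (w - v)" "norm (w - v) < b" using w'(1,2) vv[of w] \<eta> by linarith+
  have "norm w < M" using ab(2) norm_triangle_sub[of w v] by (simp add: M_def)
  from yy[OF this] have "ereal (c' + blinfun_apply y' w) \<le> ereal (c + blinfun_apply y w)"
    using \<theta>(3) by simp
  then have "f w < ereal (c + blinfun_apply y w)" using w'(3) by (rule less_le_trans[rotated])
  then have "w \<in> annular_sublevel f v y a b c" using ab by (simp add: annular_sublevel_def)
  then show "annular_sublevel f v y a b c \<inter> W \<noteq> {}" using w(1) by blast
qed

lemma norming_UN:
  assumes "\<And>n::nat. norming (Y n) W"
  shows "norming (closure (\<Union>n. Y n)) W"
proof (rule norming_closure)
  fix y q assume "y \<in> (\<Union>n. Y n)" "\<exists>x. q * norm x < \<bar>blinfun_apply y x\<bar>"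
  then show "\<exists>x\<in>W. q * norm x < \<bar>blinfun_apply y x\<bar>"
    using assms unfolding norming_def by blast
qed

lemma witnessed_UN:
  assumes inc: "incseq V" "incseq Y" and wit: "\<And>n. witnessed f (V n) (Y n) W"
  shows "witnessed f (closure (\<Union>n. V n)) (closure (\<Union>n. Y n)) W"
proof (rule witnessed_closure)
  fix v y a b c assume "v \<in> (\<Union>n. V n)" "y \<in> (\<Union>n. Y n)" and ne: "annular_sublevel f v y a b c \<noteq> {}"
  then obtain m n where mn: "v \<in> V m" "y \<in> Y n" by blast
  have "V m \<subseteq> V (max m n)" "Y n \<subseteq> Y (max m n)" using inc by (simp_all add: incseqD)
  then have "v \<in> V (max m n)" "y \<in> Y (max m n)" using mn by auto
  then show "annular_sublevel f v y a b c \<inter> W \<noteq> {}"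
    using wit[of "max m n"] ne unfolding witnessed_def by blast
qed

text \<open>Over countable sets and rational parameters there are only countably many requirements;
  one chosen solution for each suffices by the two closure lemmas.\<close>

lemma countable_witnesses:
  fixes C :: "'a::real_normed_vector set" and D :: "('a \<Rightarrow>\<^sub>L real) set"
  assumes C: "countable C" and D: "countable D"
  shows "\<exists>T. countable T \<and> witnessed f (closure C) (closure D) T \<and> norming (closure D) T"
proof -
  define p where "p = (\<lambda>(v, y, a, b, c). SOME x. x \<in> annular_sublevel f v y a b c)"
  define q where "q = (\<lambda>(y :: 'a \<Rightarrow>\<^sub>L real, c). SOME x. c * norm x < \<bar>blinfun_apply y x\<bar>)"
  define T where "T = p ` (C \<times> D \<times> \<rat> \<times> \<rat> \<times> \<rat>) \<union> q ` (D \<times> \<rat>)"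
  have "countable T"
    unfolding T_def by (intro countable_Un countable_image countable_SIGMA C D countable_rat)
  moreover have "witnessed f (closure C) (closure D) T"
  proof (rule witnessed_closure)
    fix v y a b c
    assume *: "v \<in> C" "y \<in> D" "a \<in> \<rat>" "b \<in> \<rat>" "c \<in> \<rat>" "annular_sublevel f v y a b c \<noteq> {}"
    have "p (v, y, a, b, c) \<in> annular_sublevel f v y a b c"
      using *(6) by (simp add: p_def some_in_eq)
    moreover have "p (v, y, a, b, c) \<in> T" unfolding T_def using *(1-5) by (intro UnI1 imageI) auto
    ultimately show "annular_sublevel f v y a b c \<inter> T \<noteq> {}" by blast
  qed
  moreover have "norming (closure D) T"
  proof (rule norming_closure)
    fix y c assume *: "y \<in> D" "c \<in> \<rat>" "\<exists>x. c * norm x < \<bar>blinfun_apply y x\<bar>"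
    have "c * norm (q (y, c)) < \<bar>blinfun_apply y (q (y, c))\<bar>"
      using someI_ex[OF *(3)] by (simp add: q_def)
    moreover have "q (y, c) \<in> T" unfolding T_def using *(1,2) by (intro UnI2 imageI) auto
    ultimately show "\<exists>x\<in>T. c * norm x < \<bar>blinfun_apply y x\<bar>" by blast
  qed
  ultimately show ?thesis by blast
qed

text \<open>Applied to differences in \<open>Y\<close>, this makes restriction to \<open>V\<close>
  an isometry.\<close>

lemma dual_norm_on_norming:
  assumes V: "subspace V" and nrm: "norming Y V" and z: "z \<in> Y"
  shows "(SUP v\<in>{v\<in>V. norm v \<le> 1}. \<bar>blinfun_apply z v\<bar>) = norm z"
proof (rule antisym)
  have le: "\<bar>blinfun_apply z v\<bar> \<le> norm z" if "norm v \<le> 1" for v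
    using norm_blinfun[of z v] mult_left_le[OF that norm_ge_zero[of z]] by simp
  have ne: "0 \<in> {v\<in>V. norm v \<le> 1}" using subspace_0[OF V] by simp
  then show "(SUP v\<in>{v\<in>V. norm v \<le> 1}. \<bar>blinfun_apply z v\<bar>) \<le> norm z"
    by (intro cSUP_least) (auto intro: le)
  have bdd: "bdd_above ((\<lambda>v. \<bar>blinfun_apply z v\<bar>) ` {v\<in>V. norm v \<le> 1})"
    by (intro bdd_aboveI2[of _ _ "norm z"]) (auto intro: le)
  show "norm z \<le> (SUP v\<in>{v\<in>V. norm v \<le> 1}. \<bar>blinfun_apply z v\<bar>)"
  proof (rule norming_norm_le[OF nrm z])
    show "0 \<le> (SUP v\<in>{v\<in>V. norm v \<le> 1}. \<bar>blinfun_apply z v\<bar>)"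
      using cSUP_upper[OF ne bdd] by (simp add: blinfun.zero_right)
    fix w assume w: "w \<in> V"
    show "\<bar>blinfun_apply z w\<bar> \<le> (SUP v\<in>{v\<in>V. norm v \<le> 1}. \<bar>blinfun_apply z v\<bar>) * norm w"
    proof (cases "w = 0")
      case False
      have "(1 / norm w) *\<^sub>R w \<in> {v\<in>V. norm v \<le> 1}" using False w subspace_scale[OF V] by simp
      from cSUP_upper[OF this bdd] show ?thesis
        using False by (simp add: blinfun.scaleR_right abs_mult field_simps)
    qed (simp add: blinfun.zero_right)
  qed
qed

section \<open>Lifting Frechet subgradients from a subspace\<close>

lemma difference_quotient_iff:
  assumes "f x \<noteq> - \<infinity>" "h \<noteq> 0"
  shows "ereal (1 / norm h) * (f x - ereal r - ereal s) > ereal (- \<epsilon>) \<longleftrightarrow> f x > ereal (r + s - \<epsilon> * norm h)"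
proof (cases "f x")
  case (real t)
  have "- \<epsilon> < (1 / norm h) * (t - r - s) \<longleftrightarrow> r + s - \<epsilon> * norm h < t"
    using assms(2) by (simp add: field_simps)
  then show ?thesis using real by simp
qed (use assms in auto)

text \<open>A point \<open>v + h\<close> violating the inequality for \<open>\<epsilon>\<close>
  solves an annular problem at \<open>v\<close>. A solution in \<open>V\<close>, not much farther
  from \<open>v\<close>, would violate the inequality for \<open>\<epsilon> / 2\<close> inside
  \<open>V\<close>.\<close>

lemma frechet_subgradient_extend:
  assumes inf: "\<And>x. f x \<noteq> - \<infinity>" and V: "subspace V" and wit: "witnessed f V Y V"
    and v: "v \<in> V" and y: "y \<in> Y" and sub: "frechet_subgradient_on V f v (blinfun_apply y)"
  shows "frechet_subgradient_on UNIV f v (blinfun_apply y)"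
proof -
  have "f v < \<infinity>" using sub by (simp add: frechet_subgradient_on_def)
  then obtain r where r: "f v = ereal r" using inf[of v] by (cases "f v") auto
  have "\<exists>\<delta>>0. \<forall>h. 0 < norm h \<and> norm h < \<delta> \<longrightarrow> f (v + h) > ereal (r + blinfun_apply y h - \<epsilon> * norm h)"
    if e: "\<epsilon> > 0" for \<epsilon>
  proof -
    have "\<epsilon> / 2 > 0" using e by simp
    then obtain \<delta> where \<delta>: "\<delta> > 0" "\<forall>h\<in>V. 0 < norm h \<and> norm h < \<delta> \<longrightarrow>
        ereal (1 / norm h) * (f (v + h) - f v - ereal (blinfun_apply y h)) > ereal (- (\<epsilon> / 2))"
      using sub unfolding frechet_subgradient_on_def by blast
    have \<delta>V: "f (v + h) > ereal (r + blinfun_apply y h - \<epsilon> / 2 * norm h)"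
      if "h \<in> V" "0 < norm h" "norm h < \<delta>" for h
      using \<delta>(2) that difference_quotient_iff[of f "v + h" h "\<epsilon> / 2" r "blinfun_apply y h"] inf r by auto
    have "f (v + h) > ereal (r + blinfun_apply y h - \<epsilon> * norm h)" if h: "0 < norm h" "norm h < \<delta>" for h
    proof (rule ccontr)
      assume "\<not> ?thesis"
      then have "f (v + h) \<le> ereal (r + blinfun_apply y h - \<epsilon> * norm h)" by (simp add: not_less)
      \<comment> \<open>The factor 3/4 makes the violation at \<open>v + h\<close> strict. With
        outer radius \<open>5/4 * norm h\<close> it still exceeds the permitted
        \<open>5/8 * \<epsilon> * norm h\<close>; the inner radius 0 excludes \<open>v\<close>
        itself.\<close>
      moreover define c where "c = r - blinfun_apply y v - 3/4 * \<epsilon> * norm h"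
      have "ereal (r + blinfun_apply y h - \<epsilon> * norm h) < ereal (c + blinfun_apply y (v + h))"
        using e h by (simp add: c_def blinfun.add_right)
      ultimately have "f (v + h) < ereal (c + blinfun_apply y (v + h))" by (rule le_less_trans)
      then have "v + h \<in> annular_sublevel f v y 0 (min \<delta> (5/4 * norm h)) c"
        using h by (simp add: annular_sublevel_def)
      then have "annular_sublevel f v y 0 (min \<delta> (5/4 * norm h)) c \<noteq> {}" by blast
      then have "annular_sublevel f v y 0 (min \<delta> (5/4 * norm h)) c \<inter> V \<noteq> {}"
        using wit v y unfolding witnessed_def by blast
      then obtain x where "x \<in> V" "x \<in> annular_sublevel f v y 0 (min \<delta> (5/4 * norm h)) c" by blast
      then have x: "x \<in> V" "0 < norm (x - v)" "norm (x - v) < \<delta>" "norm (x - v) < 5/4 * norm h"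
        "f x < ereal (c + blinfun_apply y x)"
        by (simp_all add: annular_sublevel_def)
      have xv: "x - v \<in> V" using V x(1) v by (rule subspace_diff)
      have "f x > ereal (r + blinfun_apply y (x - v) - \<epsilon> / 2 * norm (x - v))"
        using \<delta>V[OF xv x(2,3)] by simp
      from less_trans[OF this x(5)]
      have "r + blinfun_apply y (x - v) - \<epsilon> / 2 * norm (x - v) < c + blinfun_apply y x" by simp
      then have "3/4 * \<epsilon> * norm h < \<epsilon> / 2 * norm (x - v)" by (simp add: c_def blinfun.diff_right)
      also have "\<dots> \<le> \<epsilon> / 2 * (5/4 * norm h)" using x(4) e by (intro mult_left_mono) auto
      finally show False using e h by simp
    qed
    then show ?thesis using \<delta>(1) by blast
  qed
  moreover have "ereal (1 / norm h) * (f (v + h) - ereal r - ereal (blinfun_apply y h)) > ereal (- \<epsilon>) \<longleftrightarrow>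
      f (v + h) > ereal (r + blinfun_apply y h - \<epsilon> * norm h)" if "0 < norm h" for h \<epsilon>
    using that inf by (intro difference_quotient_iff) auto
  ultimately show ?thesis
    unfolding frechet_subgradient_on_def r by simp
qed

text \<open>The union over \<open>n\<close> of the selections with tolerance
  \<open>1 / real (Suc n)\<close> reaches every tolerance and preserves countability and
  openness.\<close>

lemma Asplund_generator:
  assumes "asplund_space TYPE('a::banach)"
  shows "\<exists>g :: 'a \<Rightarrow> ('a \<Rightarrow>\<^sub>L real) set. (\<forall>x. countable (g x)) \<and> (\<forall>\<xi>. open {x. \<xi> \<in> g x}) \<and>
    (\<forall>x. \<forall>e>0. \<exists>\<xi>\<in>g x. \<exists>j. norm j \<le> 1 \<and> blinfun_apply j x = norm x \<and> norm (j - \<xi>) \<le> e)"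
proof -
  define Q where "Q e x \<xi> \<longleftrightarrow> (\<exists>j. norm j \<le> 1 \<and> blinfun_apply j x = norm x \<and> norm (j - \<xi>) \<le> e)"
    for e and x :: 'a and \<xi> :: "'a \<Rightarrow>\<^sub>L real"
  have "\<exists>g :: 'a \<Rightarrow> ('a \<Rightarrow>\<^sub>L real) set. (\<forall>x. countable (g x)) \<and> (\<forall>\<xi>. open {x. \<xi> \<in> g x}) \<and>
      (\<forall>x. \<exists>\<xi>\<in>g x. Q (1 / real (Suc n)) x \<xi>)" for n
    by (rule locally_constant_selection, unfold Q_def, rule Asplund_local_selection[OF assms]) simp_all
  then have "\<forall>n. \<exists>g :: 'a \<Rightarrow> ('a \<Rightarrow>\<^sub>L real) set. (\<forall>x. countable (g x)) \<and> (\<forall>\<xi>. open {x. \<xi> \<in> g x}) \<and>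
      (\<forall>x. \<exists>\<xi>\<in>g x. Q (1 / real (Suc n)) x \<xi>)" by (rule allI)
  from choice[OF this] obtain g :: "nat \<Rightarrow> 'a \<Rightarrow> ('a \<Rightarrow>\<^sub>L real) set"
    where g: "\<forall>n. (\<forall>x. countable (g n x)) \<and> (\<forall>\<xi>. open {x. \<xi> \<in> g n x}) \<and>
      (\<forall>x. \<exists>\<xi>\<in>g n x. Q (1 / real (Suc n)) x \<xi>)" by (elim exE)
  have "\<exists>\<xi>\<in>(\<Union>n. g n x). Q e x \<xi>" if e: "e > 0" for x e
  proof -
    obtain n where n: "1 / real (Suc n) < e" using nat_approx_posE[OF e] by blast
    obtain \<xi> where \<xi>: "\<xi> \<in> g n x" "Q (1 / real (Suc n)) x \<xi>" using g by blast
    have "Q e x \<xi>" using \<xi>(2) n unfolding Q_def by (meson less_imp_le order_trans)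
    then show ?thesis using \<xi>(1) by blast
  qed
  moreover have "open {x. \<xi> \<in> (\<Union>n. g n x)}" for \<xi>
  proof -
    have "{x. \<xi> \<in> (\<Union>n. g n x)} = (\<Union>n. {x. \<xi> \<in> g n x})" by auto
    then show ?thesis using g by (simp only:) (intro open_UN ballI, simp)
  qed
  moreover have "countable (\<Union>n. g n x)" for x using g by (intro countable_UN) auto
  ultimately show ?thesis unfolding Q_def by (intro exI[of _ "\<lambda>x. \<Union>n. g n x"]) simp
qed

section \<open>Separable closed subspaces\<close>

lemma separable_closed_subspaces_iff:
  "V \<in> separable_closed_subspaces \<longleftrightarrow>
    subspace V \<and> closed V \<and> (\<exists>C. countable C \<and> C \<subseteq> V \<and> V \<subseteq> closure C)"
proof -
  have "top_of_set V closure_of C = V \<longleftrightarrow> V \<subseteq> closure C" if "C \<subseteq> V" for C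
    using that by (simp add: closure_of_subtopology Int_absorb1 inf.order_iff eq_commute)
  then have "separable_space (top_of_set V) \<longleftrightarrow> (\<exists>C. countable C \<and> C \<subseteq> V \<and> V \<subseteq> closure C)"
    unfolding separable_space_def by (intro ex_cong1) auto
  then show ?thesis by (simp add: separable_closed_subspaces_def)
qed

lemma closure_span_separable:
  fixes G :: "'a::real_normed_vector set"
  assumes "countable G"
  shows "closure (span G) \<in> separable_closed_subspaces"
proof -
  obtain D where D: "countable D" "closure D = closure (span G)"
    using countable_dense_span[OF assms] by blast
  then have "D \<subseteq> closure (span G)" using closure_subset by blast
  then show ?thesis
    unfolding separable_closed_subspaces_iff
    using D by (auto intro!: subspace_closure exI[of _ D])
qed

lemma closure_UN_separable:
  fixes V :: "nat \<Rightarrow> 'a::real_normed_vector set"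
  assumes inc: "incseq V" and V: "\<And>n. V n \<in> separable_closed_subspaces"
  shows "closure (\<Union>n. V n) \<in> separable_closed_subspaces"
proof -
  have "\<forall>n. \<exists>C. countable C \<and> C \<subseteq> V n \<and> V n \<subseteq> closure C"
    using V by (simp add: separable_closed_subspaces_iff)
  from choice[OF this] obtain C where C: "\<forall>n. countable (C n) \<and> C n \<subseteq> V n \<and> V n \<subseteq> closure (C n)"
    by (elim exE)
  have "V n \<subseteq> closure (\<Union>n. C n)" for n
    using C closure_mono[of "C n" "\<Union>n. C n"] by blast
  then have "closure (\<Union>n. V n) \<subseteq> closure (\<Union>n. C n)"
    by (intro closure_minimal) auto
  moreover have "(\<Union>n. C n) \<subseteq> closure (\<Union>n. V n)"
    using C closure_subset[of "\<Union>n. V n"] by blast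
  moreover have "countable (\<Union>n. C n)" using C by (intro countable_UN) auto
  moreover have "subspace (closure (\<Union>n. V n))"
    by (intro subspace_closure subspace_UN_incseq inc)
      (use V in \<open>simp add: separable_closed_subspaces_iff\<close>)
  ultimately show ?thesis unfolding separable_closed_subspaces_iff by blast
qed

section \<open>The dual hull and the reducing family of rectangles\<close>

locale dual_generator =
  fixes g :: "'a::banach \<Rightarrow> ('a \<Rightarrow>\<^sub>L real) set"
  assumes countable_g: "countable (g x)"
    and open_g: "open {x. \<xi> \<in> g x}"
    and near_g: "e > 0 \<Longrightarrow> \<exists>\<xi>\<in>g x. \<exists>j. norm j \<le> 1 \<and> blinfun_apply j x = norm x \<and> norm (j - \<xi>) \<le> e"
begin

definition values_on :: "'a set \<Rightarrow> ('a \<Rightarrow>\<^sub>L real) set" where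
  "values_on V = (\<Union>x\<in>V. g x)"

definition dual_hull :: "'a set \<Rightarrow> ('a \<Rightarrow>\<^sub>L real) set" where
  "dual_hull V = closure (span (values_on V))"

text \<open>An open set that meets the closure of \<open>C\<close> meets \<open>C\<close>. This
  makes the values on a separable set countable and lets the hull commute with closures of
  unions.\<close>

lemma values_on_closure: "values_on (closure C) = values_on C"
proof
  show "values_on (closure C) \<subseteq> values_on C"
  proof
    fix \<xi> assume "\<xi> \<in> values_on (closure C)"
    then have "{x. \<xi> \<in> g x} \<inter> closure C \<noteq> {}" by (auto simp: values_on_def)
    then have "{x. \<xi> \<in> g x} \<inter> C \<noteq> {}" using open_Int_closure_eq_empty[OF open_g] by blast
    then show "\<xi> \<in> values_on C" by (auto simp: values_on_def)
  qed
  show "values_on C \<subseteq> values_on (closure C)"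
    unfolding values_on_def by (rule UN_mono[OF closure_subset]) simp
qed

lemma countable_values_on:
  assumes "V \<in> separable_closed_subspaces"
  shows "countable (values_on V)"
proof -
  obtain C where C: "countable C" "V \<subseteq> closure C"
    using assms unfolding separable_closed_subspaces_iff by blast
  have "values_on V \<subseteq> values_on (closure C)"
    unfolding values_on_def by (rule UN_mono[OF C(2)]) simp
  also have "\<dots> = values_on C" by (rule values_on_closure)
  finally show ?thesis
    by (rule countable_subset) (simp add: values_on_def C(1) countable_g)
qed

lemma dual_hull_separable:
  "V \<in> separable_closed_subspaces \<Longrightarrow> dual_hull V \<in> separable_closed_subspaces"
  unfolding dual_hull_def by (intro closure_span_separable countable_values_on)

lemma dual_hull_mono: "V \<subseteq> V' \<Longrightarrow> dual_hull V \<subseteq> dual_hull V'"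
  unfolding dual_hull_def values_on_def by (intro closure_mono span_mono UN_mono) auto

text \<open>The countably many values on \<open>V\<close> approximate a norming functional at every
  point of \<open>V\<close>, as \<open>near_boundary_span\<close> requires.\<close>

lemma dual_hull_dense:
  assumes V: "V \<in> separable_closed_subspaces" and e: "e > 0"
  shows "\<exists>y\<in>dual_hull V. \<forall>v\<in>V. \<bar>blinfun_apply h v - blinfun_apply y v\<bar> \<le> e * norm v"
proof -
  have sV: "subspace V" "closed V" using V by (auto simp: separable_closed_subspaces_iff)
  \<comment> \<open>\<open>from_nat_into\<close> has a countable set as its exact range only if the
    set is nonempty.\<close>
  have "g 0 \<noteq> {}" using near_g[of 1 0] by auto
  then have "values_on V \<noteq> {}" using subspace_0[OF sV(1)] by (auto simp: values_on_def)
  then have rng: "range (from_nat_into (values_on V)) = values_on V"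
    using countable_values_on[OF V] by (rule range_from_nat_into)
  \<comment> \<open>Chosen so that \<open>2 * d * norm h \<le> e\<close>; the summand 1 keeps the
    denominator positive when \<open>h = 0\<close>.\<close>
  define d where "d = e / (2 * norm h + 1)"
  have np: "2 * norm h + 1 > 0" by (simp add: add_nonneg_pos)
  then have d: "d > 0" using e by (simp add: d_def)
  have "\<exists>y\<in>span (range (from_nat_into (values_on V))). \<forall>v\<in>V.
      \<bar>blinfun_apply h v - blinfun_apply y v\<bar> \<le> 2 * d * norm h * norm v"
  proof (rule near_boundary_span[OF sV d])
    fix x assume "x \<in> V"
    obtain \<xi> j where *: "\<xi> \<in> g x" "norm j \<le> 1" "blinfun_apply j x = norm x" "norm (j - \<xi>) \<le> d"
      using near_g[OF d, of x] by blast
    have "\<xi> \<in> range (from_nat_into (values_on V))"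
      unfolding rng using *(1) \<open>x \<in> V\<close> by (auto simp: values_on_def)
    then obtain i where "\<xi> = from_nat_into (values_on V) i" by (elim imageE)
    then show "\<exists>i j. norm j \<le> 1 \<and> blinfun_apply j x = norm x \<and> norm (j - from_nat_into (values_on V) i) \<le> d"
      using *(2-4) by (intro exI[of _ i] exI[of _ j]) simp
  qed
  then obtain y where y: "y \<in> span (values_on V)"
    "\<And>v. v \<in> V \<Longrightarrow> \<bar>blinfun_apply h v - blinfun_apply y v\<bar> \<le> 2 * d * norm h * norm v"
    unfolding rng by blast
  have "2 * d * norm h \<le> e"
  proof -
    have "2 * d * norm h \<le> d * (2 * norm h + 1)" using d by (simp add: algebra_simps)
    also have "\<dots> = e" using np by (simp add: d_def)
    finally show ?thesis .
  qed
  then have "\<bar>blinfun_apply h v - blinfun_apply y v\<bar> \<le> e * norm v" if "v \<in> V" for v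
    using y(2)[OF that] mult_right_mono[of "2 * d * norm h" e "norm v"] by simp
  moreover have "y \<in> dual_hull V" using y(1) closure_subset by (auto simp: dual_hull_def)
  ultimately show ?thesis by blast
qed

text \<open>Approximate \<open>h\<close> on \<open>V\<close> from the hull. Since \<open>V\<close>
  norms the hull, closeness on \<open>V\<close> is closeness in norm, so the approximants form a
  Cauchy sequence, whose limit lies in the hull.\<close>

lemma dual_hull_onto:
  assumes V: "V \<in> separable_closed_subspaces" and nrm: "norming (dual_hull V) V"
  shows "\<exists>y\<in>dual_hull V. \<forall>v\<in>V. blinfun_apply y v = blinfun_apply h v"
proof -
  let ?Y = "dual_hull V"
  have Y: "subspace ?Y" "closed ?Y"
    using dual_hull_separable[OF V] by (auto simp: separable_closed_subspaces_iff)
  have "\<forall>n. \<exists>y. y \<in> ?Y \<and> (\<forall>v\<in>V. \<bar>blinfun_apply h v - blinfun_apply y v\<bar> \<le> inverse (real (Suc n)) * norm v)"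
    using dual_hull_dense[OF V, of "inverse (real (Suc _))" h] by (simp add: Bex_def)
  from choice[OF this] obtain y where y: "\<And>n. y n \<in> ?Y"
    "\<And>n v. v \<in> V \<Longrightarrow> \<bar>blinfun_apply h v - blinfun_apply (y n) v\<bar> \<le> inverse (real (Suc n)) * norm v"
    by blast
  have dist: "dist (y m) (y n) \<le> inverse (real (Suc m)) + inverse (real (Suc n))" for m n
    unfolding dist_norm
  proof (rule norming_norm_le[OF nrm])
    show "y m - y n \<in> ?Y" using y(1) by (intro subspace_diff[OF Y(1)])
    fix v assume v: "v \<in> V"
    show "\<bar>blinfun_apply (y m - y n) v\<bar> \<le> (inverse (real (Suc m)) + inverse (real (Suc n))) * norm v"
      using y(2)[OF v, of m] y(2)[OF v, of n] by (simp only: blinfun.diff_left distrib_right)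
  qed simp
  have "Cauchy y"
  proof (rule metric_CauchyI)
    fix e :: real assume "e > 0"
    then obtain N where N: "inverse (real (Suc N)) < e / 2" using reals_Archimedean[of "e / 2"] by auto
    have "dist (y m) (y n) < e" if "m \<ge> N" "n \<ge> N" for m n
    proof -
      have "inverse (real (Suc m)) \<le> inverse (real (Suc N))" "inverse (real (Suc n)) \<le> inverse (real (Suc N))"
        using that by (auto intro!: le_imp_inverse_le)
      then show ?thesis using dist[of m n] N by linarith
    qed
    then show "\<exists>M. \<forall>m\<ge>M. \<forall>n\<ge>M. dist (y m) (y n) < e" by blast
  qed
  then obtain z where z: "y \<longlonglongrightarrow> z" using Cauchy_convergent convergent_def by blast
  have "z \<in> ?Y" using closed_sequentially[OF Y(2) y(1) z] .
  moreover have "blinfun_apply z v = blinfun_apply h v" if v: "v \<in> V" for v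
  proof -
    have "(\<lambda>n. blinfun_apply (y n) v) \<longlonglongrightarrow> blinfun_apply z v"
      by (intro blinfun.tendsto z tendsto_const)
    moreover have "(\<lambda>n. blinfun_apply (y n) v - blinfun_apply h v) \<longlonglongrightarrow> 0"
    proof (rule Lim_null_comparison)
      show "\<forall>\<^sub>F n in sequentially. norm (blinfun_apply (y n) v - blinfun_apply h v) \<le> inverse (real (Suc n)) * norm v"
        using y(2)[OF v] by (simp add: abs_minus_commute)
      show "(\<lambda>n. inverse (real (Suc n)) * norm v) \<longlonglongrightarrow> 0"
        using tendsto_mult_left_zero[OF LIMSEQ_inverse_real_of_nat] .
    qed
    then have "(\<lambda>n. blinfun_apply (y n) v) \<longlonglongrightarrow> blinfun_apply h v" by (rule LIM_zero_cancel)
    ultimately show ?thesis by (rule LIMSEQ_unique)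
  qed
  ultimately show ?thesis by blast
qed

definition reducing_family :: "('a \<Rightarrow> ereal) \<Rightarrow> ('a \<times> ('a \<Rightarrow>\<^sub>L real)) set set" where
  "reducing_family f = {V \<times> dual_hull V | V.
     V \<in> separable_closed_subspaces \<and> norming (dual_hull V) V \<and> witnessed f V (dual_hull V) V}"

text \<open>The factors can be read off the product because both contain 0 and so are
  nonempty.\<close>

lemma in_reducing_family_iff:
  "V \<times> Y \<in> reducing_family f \<longleftrightarrow> Y = dual_hull V \<and> V \<in> separable_closed_subspaces \<and>
     norming Y V \<and> witnessed f V Y V"
proof
  assume "V \<times> Y \<in> reducing_family f"
  then obtain W where W: "V \<times> Y = W \<times> dual_hull W" "W \<in> separable_closed_subspaces"
    "norming (dual_hull W) W" "witnessed f W (dual_hull W) W"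
    unfolding reducing_family_def by blast
  have "0 \<in> W" "0 \<in> dual_hull W"
    using W(2) dual_hull_separable[OF W(2)]
    by (auto simp: separable_closed_subspaces_iff intro: subspace_0)
  then have "V = W" "Y = dual_hull W" using W(1) by (auto simp: times_eq_iff)
  then show "Y = dual_hull V \<and> V \<in> separable_closed_subspaces \<and> norming Y V \<and> witnessed f V Y V"
    using W by simp
qed (auto simp: reducing_family_def)

text \<open>By \<open>values_on_closure\<close> only values at points of some \<open>V n\<close>
  enter, and the increasing spans of these have a subspace as union.\<close>

lemma dual_hull_UN:
  assumes inc: "incseq V"
  shows "dual_hull (closure (\<Union>n. V n)) = closure (\<Union>n. dual_hull (V n))"
proof
  let ?S = "\<lambda>n. span (values_on (V n))"
  have "incseq ?S"
    using inc unfolding incseq_def values_on_def by (intro allI impI span_mono UN_mono) auto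
  then have "subspace (\<Union>n. ?S n)" by (rule subspace_UN_incseq) simp
  moreover have "values_on (\<Union>n. V n) \<subseteq> (\<Union>n. ?S n)"
    by (auto simp: values_on_def intro: span_base)
  ultimately have "span (values_on (\<Union>n. V n)) \<subseteq> (\<Union>n. ?S n)" by (rule span_minimal[rotated])
  also have "\<dots> \<subseteq> (\<Union>n. dual_hull (V n))" unfolding dual_hull_def by (intro UN_mono closure_subset) auto
  finally show "dual_hull (closure (\<Union>n. V n)) \<subseteq> closure (\<Union>n. dual_hull (V n))"
    unfolding dual_hull_def[of "closure _"] values_on_closure by (rule closure_mono)
  have "dual_hull (V n) \<subseteq> dual_hull (closure (\<Union>n. V n))" for n
    by (rule dual_hull_mono, rule order_trans[OF UN_upper closure_subset]) simp
  moreover have "closed (dual_hull (closure (\<Union>n. V n)))" by (simp add: dual_hull_def)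
  ultimately show "closure (\<Union>n. dual_hull (V n)) \<subseteq> dual_hull (closure (\<Union>n. V n))"
    by (intro closure_minimal) auto
qed

lemma sigma_complete_reducing_family: "sigma_complete_family (reducing_family f)"
  unfolding sigma_complete_family_def
proof (intro allI impI, elim conjE)
  fix V Y
  assume R: "\<forall>i::nat. V i \<times> Y i \<in> reducing_family f" and inc: "\<forall>i. V i \<times> Y i \<subseteq> V (Suc i) \<times> Y (Suc i)"
  note R' = R[unfolded in_reducing_family_iff, rule_format]
  have V: "V i \<in> separable_closed_subspaces" and Y: "Y i = dual_hull (V i)"
    and nrm: "norming (Y i) (V i)" and wit: "witnessed f (V i) (Y i) (V i)" for i
    by (rule R'[THEN conjunct2, THEN conjunct1] R'[THEN conjunct1]
        R'[THEN conjunct2, THEN conjunct2, THEN conjunct1]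
        R'[THEN conjunct2, THEN conjunct2, THEN conjunct2])+
  have "0 \<in> V i" "0 \<in> Y i" for i
    using V[of i] dual_hull_separable[OF V[of i]] unfolding Y[of i]
    by (auto simp: separable_closed_subspaces_iff intro: subspace_0)
  then have "V i \<subseteq> V (Suc i)" "Y i \<subseteq> Y (Suc i)" for i
    using inc[unfolded times_subset_iff, rule_format, of i] by (metis empty_iff)+
  then have incV: "incseq V" and incY: "incseq Y" by (simp_all add: incseq_SucI)
  let ?V = "closure (\<Union>i. V i)" and ?Y = "closure (\<Union>i. Y i)"
  have VV: "V i \<subseteq> ?V" for i by (rule order_trans[OF UN_upper closure_subset]) simp
  have "?Y = dual_hull ?V" using dual_hull_UN[OF incV] Y by simp
  moreover have "?V \<in> separable_closed_subspaces" by (rule closure_UN_separable[OF incV V])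
  moreover have "norming ?Y ?V" by (rule norming_UN) (rule norming_mono[OF nrm order_refl VV])
  moreover have "witnessed f ?V ?Y ?V"
    by (rule witnessed_UN[OF incV incY]) (rule witnessed_mono[OF wit order_refl order_refl VV])
  ultimately show "?V \<times> ?Y \<in> reducing_family f" unfolding in_reducing_family_iff by blast
qed

text \<open>The hull of \<open>V\<close> need not contain \<open>Y\<^sub>0\<close> a priori. Therefore \<open>V\<close> is built so as to norm the larger
  space \<open>Z\<close>; since every functional in \<open>Y\<^sub>0\<close> agrees on \<open>V\<close> with one in the hull, it belongs to the hull.\<close>

lemma cofinal_reducing_family: "cofinal_family (reducing_family f)"
  unfolding cofinal_family_def
proof
  fix S :: "('a \<times> ('a \<Rightarrow>\<^sub>L real)) set" assume "S \<in> rectangles"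
  then obtain V\<^sub>0 Y\<^sub>0 where S: "S = V\<^sub>0 \<times> Y\<^sub>0" "V\<^sub>0 \<in> separable_closed_subspaces" "Y\<^sub>0 \<in> separable_closed_subspaces"
    unfolding rectangles_def by (elim CollectE exE conjE)
  obtain C\<^sub>0 where C0: "countable C\<^sub>0" "V\<^sub>0 \<subseteq> closure C\<^sub>0"
    using S(2) unfolding separable_closed_subspaces_iff by blast
  obtain D\<^sub>0 where D0: "countable D\<^sub>0" "Y\<^sub>0 \<subseteq> closure D\<^sub>0"
    using S(3) unfolding separable_closed_subspaces_iff by blast
  define V' where "V' C = closure (span C)" for C :: "'a set"
  define Z' where "Z' C = closure (span (values_on (V' C) \<union> D\<^sub>0))" for C
  have sep: "V' C \<in> separable_closed_subspaces" "countable (values_on (V' C) \<union> D\<^sub>0)" if "countable C" for C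
    using that D0(1) closure_span_separable countable_values_on by (auto simp: V'_def)
  have "\<forall>C. \<exists>T. countable C \<longrightarrow> countable T \<and> C \<subseteq> T \<and> witnessed f (V' C) (Z' C) T \<and> norming (Z' C) T"
  proof
    fix C
    show "\<exists>T. countable C \<longrightarrow> countable T \<and> C \<subseteq> T \<and> witnessed f (V' C) (Z' C) T \<and> norming (Z' C) T"
    proof (cases "countable C")
      case True
      obtain A where A: "countable A" "closure A = V' C"
        using countable_dense_span[OF True] unfolding V'_def by blast
      obtain B where B: "countable B" "closure B = Z' C"
        using countable_dense_span[OF sep(2)[OF True]] unfolding Z'_def by blast
      obtain T where T: "countable T" "witnessed f (V' C) (Z' C) T" "norming (Z' C) T"
        using countable_witnesses[OF A(1) B(1), of f] unfolding A(2) B(2) by blast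
      have "witnessed f (V' C) (Z' C) (C \<union> T)" "norming (Z' C) (C \<union> T)"
        using T by (auto intro: witnessed_mono norming_mono)
      then show ?thesis using True T(1) by (intro exI[of _ "C \<union> T"]) simp
    qed simp
  qed
  from choice[OF this] obtain F where
    F: "\<And>C. countable C \<Longrightarrow> countable (F C) \<and> C \<subseteq> F C \<and> witnessed f (V' C) (Z' C) (F C) \<and> norming (Z' C) (F C)"
    by blast
  \<comment> \<open>Closing off: \<open>C (Suc n)\<close> contains the witnesses and norming points
    demanded at stage \<open>n\<close>, so the limit \<open>V\<close> serves all stages.\<close>
  define C where "C n = (F ^^ n) C\<^sub>0" for n
  have CS: "C (Suc n) = F (C n)" and C00: "C 0 = C\<^sub>0" for n by (simp_all add: C_def)
  have cC: "countable (C n)" for n by (induction n) (use C0 F in \<open>auto simp: CS C00\<close>)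
  have "incseq C" by (rule incseq_SucI) (use F[OF cC] CS in simp)
  then have incV: "incseq (\<lambda>n. V' (C n))"
    unfolding incseq_def V'_def by (intro allI impI closure_mono span_mono) simp
  then have incZ: "incseq (\<lambda>n. Z' (C n))"
    unfolding incseq_def Z'_def values_on_def
    by (intro allI impI closure_mono span_mono Un_mono UN_mono) auto
  define V where "V = closure (\<Union>n. V' (C n))"
  define Z where "Z = closure (\<Union>n. Z' (C n))"
  have V: "V \<in> separable_closed_subspaces"
    unfolding V_def by (rule closure_UN_separable[OF incV]) (rule sep(1)[OF cC])
  have Z: "subspace Z"
    using closure_UN_separable[OF incZ] closure_span_separable[OF sep(2)[OF cC]]
    unfolding Z_def Z'_def by (simp add: separable_closed_subspaces_iff)
  have V'V: "V' (C n) \<subseteq> V" for n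
    unfolding V_def by (rule order_trans[OF UN_upper closure_subset]) simp
  have Z'Z: "Z' (C n) \<subseteq> Z" for n
    unfolding Z_def by (rule order_trans[OF UN_upper closure_subset]) simp
  have "A \<subseteq> V' A" for A
    unfolding V'_def by (rule order_trans[OF span_superset closure_subset])
  then have CV: "C n \<subseteq> V" for n using V'V by blast
  have hullZ: "dual_hull V \<subseteq> Z"
  proof -
    have "dual_hull (V' (C n)) \<subseteq> Z' (C n)" for n
      unfolding dual_hull_def Z'_def by (intro closure_mono span_mono) simp
    then have "(\<Union>n. dual_hull (V' (C n))) \<subseteq> (\<Union>n. Z' (C n))" by (intro UN_mono) auto
    then show ?thesis unfolding V_def Z_def dual_hull_UN[OF incV] by (rule closure_mono)
  qed
  have nrmZ: "norming Z V"
    unfolding Z_def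
  proof (rule norming_UN)
    show "norming (Z' (C n)) V" for n
      using F[OF cC, of n] CV[of "Suc n"] norming_mono[OF _ order_refl, of "Z' (C n)" "F (C n)" V]
      by (simp add: CS)
  qed
  have witZ: "witnessed f V Z V"
  proof -
    have "witnessed f (V' (C n)) (Z' (C n)) V" for n
      using F[OF cC, of n] CV[of "Suc n"]
        witnessed_mono[OF _ order_refl order_refl, of f "V' (C n)" "Z' (C n)" "F (C n)" V]
      by (simp add: CS)
    from witnessed_UN[OF incV incZ this] show ?thesis by (simp add: V_def Z_def)
  qed
  have nrm: "norming (dual_hull V) V" by (rule norming_mono[OF nrmZ hullZ order_refl])
  have "V \<times> dual_hull V \<in> reducing_family f"
    unfolding in_reducing_family_iff
    using V nrm witnessed_mono[OF witZ order_refl hullZ order_refl] by blast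
  moreover have "V\<^sub>0 \<subseteq> V"
  proof -
    have "closure C\<^sub>0 \<subseteq> V" using CV[of 0] by (intro closure_minimal) (simp_all add: C00 V_def)
    then show ?thesis using C0(2) by blast
  qed
  moreover have "Y\<^sub>0 \<subseteq> dual_hull V"
  proof
    fix y0 assume "y0 \<in> Y\<^sub>0"
    moreover have "D\<^sub>0 \<subseteq> Z' (C 0)"
      unfolding Z'_def by (rule order_trans[OF order_trans[OF Un_upper2 span_superset] closure_subset])
    then have "closure D\<^sub>0 \<subseteq> Z" using Z'Z[of 0] by (intro closure_minimal) (auto simp: Z_def)
    ultimately have y0: "y0 \<in> Z" using D0(2) by blast
    obtain y where y: "y \<in> dual_hull V" "\<forall>v\<in>V. blinfun_apply y v = blinfun_apply y0 v"
      using dual_hull_onto[OF V nrm] by blast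
    have "norm (y - y0) \<le> 0"
    proof (rule norming_norm_le[OF nrmZ])
      show "y - y0 \<in> Z" using y(1) hullZ y0 by (intro subspace_diff[OF Z]) auto
    qed (use y(2) in \<open>auto simp: blinfun.diff_left\<close>)
    then show "y0 \<in> dual_hull V" using y(1) by simp
  qed
  ultimately show "\<exists>R\<in>reducing_family f. S \<subseteq> R"
    unfolding S(1) by (intro bexI[of _ "V \<times> dual_hull V"] Sigma_mono)
qed

lemma rich_reducing_family: "rich_rectangle_family (reducing_family f)"
proof -
  have "reducing_family f \<subseteq> rectangles"
    unfolding reducing_family_def rectangles_def using dual_hull_separable by blast
  then show ?thesis
    unfolding rich_rectangle_family_def
    using cofinal_reducing_family sigma_complete_reducing_family by blast
qed

end

section \<open>Duals of subspaces and the rectangles of the reducing family\<close>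

lemma restrict_functional_in_dual_on:
  assumes "subspace V"
  shows "restrict_functional V xs \<in> dual_on V"
proof -
  have "\<bar>blinfun_apply xs x\<bar> \<le> norm xs * norm x" for x using norm_blinfun[of xs x] by simp
  then show ?thesis
    using assms by (auto simp: dual_on_def restrict_functional_def subspace_def blinfun.add_right
        blinfun.scaleR_right)
qed

lemma dual_on_extend:
  assumes V: "subspace V" and h: "h \<in> dual_on V"
  shows "\<exists>xs. \<forall>v\<in>V. blinfun_apply xs v = h v"
proof -
  have "\<exists>K. \<forall>x\<in>V. \<bar>h x\<bar> \<le> K * norm x" using h by (simp add: dual_on_def)
  then obtain K where K: "\<And>x. x \<in> V \<Longrightarrow> \<bar>h x\<bar> \<le> K * norm x" by blast
  \<comment> \<open>\<open>K\<close> may be negative when \<open>V\<close> is trivial, whereas the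
    extension asks for a nonnegative bound.\<close>
  have "\<exists>F :: 'a \<Rightarrow>\<^sub>L real. (\<forall>x\<in>V. blinfun_apply F x = h x) \<and> norm F \<le> max K 0"
  proof (rule Hahn_Banach[OF V])
    show "h x \<le> max K 0 * norm x" if "x \<in> V" for x
    proof -
      have "K * norm x \<le> max K 0 * norm x" by (intro mult_right_mono) auto
      then show ?thesis using K[OF that] by linarith
    qed
  qed (use h in \<open>auto simp: dual_on_def\<close>)
  then show ?thesis by blast
qed

lemma frechet_subgradient_on_cong:
  "(\<And>v. v \<in> V \<Longrightarrow> g v = h v) \<Longrightarrow> frechet_subgradient_on V f x g \<longleftrightarrow> frechet_subgradient_on V f x h"
  unfolding frechet_subgradient_on_def by simp

lemma frechet_subgradient_on_subset:
  "frechet_subgradient_on W f x g \<Longrightarrow> V \<subseteq> W \<Longrightarrow> frechet_subgradient_on V f x g"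
  unfolding frechet_subgradient_on_def by (meson subsetD)

theorem theorem3p1:
  fixes f :: "'a::banach \<Rightarrow> ereal"
  assumes asplund: "asplund_space TYPE('a)"
    and not_minus_infinity: "\<And>x. f x \<noteq> -\<infinity>"
    and proper: "\<exists>x. f x \<noteq> \<infinity>"
  shows "\<exists>\<R> :: ('a \<times> ('a \<Rightarrow>\<^sub>L real)) set set.
    rich_rectangle_family \<R> \<and>
    (\<forall>V\<^sub>1 Y\<^sub>1 V\<^sub>2 Y\<^sub>2. V\<^sub>1 \<times> Y\<^sub>1 \<in> \<R> \<and> V\<^sub>2 \<times> Y\<^sub>2 \<in> \<R> \<and> V\<^sub>1 \<subseteq> V\<^sub>2 \<longrightarrow> Y\<^sub>1 \<subseteq> Y\<^sub>2) \<and>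
    (\<forall>V Y. V \<times> Y \<in> \<R> \<longrightarrow>
       isometry_onto_dual Y V \<and>
       (\<forall>v\<in>V.
          restrict_functional V ` (frechet_subdiff f v \<inter> Y) = restrict_functional V ` frechet_subdiff f v \<and>
          restrict_functional V ` frechet_subdiff f v = frechet_subdiff_on V f v))"
proof -
  obtain g :: "'a \<Rightarrow> ('a \<Rightarrow>\<^sub>L real) set" where "(\<forall>x. countable (g x)) \<and> (\<forall>\<xi>. open {x. \<xi> \<in> g x}) \<and>
    (\<forall>x. \<forall>e>0. \<exists>\<xi>\<in>g x. \<exists>j. norm j \<le> 1 \<and> blinfun_apply j x = norm x \<and> norm (j - \<xi>) \<le> e)"
    using Asplund_generator[OF asplund] by (elim exE)
  then interpret dual_generator g by unfold_locales simp_all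
  show ?thesis
  proof (intro exI[of _ "reducing_family f"] conjI allI impI ballI)
    show "rich_rectangle_family (reducing_family f)" by (rule rich_reducing_family)
    show "Y\<^sub>1 \<subseteq> Y\<^sub>2" if "V\<^sub>1 \<times> Y\<^sub>1 \<in> reducing_family f \<and> V\<^sub>2 \<times> Y\<^sub>2 \<in> reducing_family f \<and> V\<^sub>1 \<subseteq> V\<^sub>2"
      for V\<^sub>1 Y\<^sub>1 V\<^sub>2 Y\<^sub>2
      using that dual_hull_mono[of V\<^sub>1 V\<^sub>2] by (simp add: in_reducing_family_iff)
    fix V Y assume VY: "V \<times> Y \<in> reducing_family f"
    have V: "V \<in> separable_closed_subspaces" and Y: "Y = dual_hull V" and nrm: "norming Y V"
      and wit: "witnessed f V Y V" using VY unfolding in_reducing_family_iff by blast+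
    have sV: "subspace V" using V by (simp add: separable_closed_subspaces_iff)
    have sY: "subspace Y" unfolding Y using dual_hull_separable[OF V] by (simp add: separable_closed_subspaces_iff)
    \<comment> \<open>A functional on \<open>V\<close> is first extended to the whole space; the
      extension is then replaced by an element of \<open>Y\<close> with the same
      restriction.\<close>
    have onto: "\<exists>y\<in>Y. restrict_functional V y = h \<and> (\<forall>v\<in>V. blinfun_apply y v = h v)" if h: "h \<in> dual_on V" for h
    proof -
      obtain xs where xs: "\<forall>v\<in>V. blinfun_apply xs v = h v" using dual_on_extend[OF sV h] by blast
      obtain y where y: "y \<in> Y" "\<forall>v\<in>V. blinfun_apply y v = blinfun_apply xs v"
        using dual_hull_onto[OF V nrm[unfolded Y]] unfolding Y by blast
      have "h \<in> extensional V" using h by (simp add: dual_on_def)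
      then have "restrict_functional V y = h"
        unfolding restrict_functional_def
        by (intro extensionalityI[of _ V]) (use xs y(2) in auto)
      then show ?thesis using xs y by auto
    qed
    show "isometry_onto_dual Y V"
      unfolding isometry_onto_dual_def
    proof (intro conjI ballI)
      show "restrict_functional V ` Y = dual_on V"
        using onto restrict_functional_in_dual_on[OF sV] by blast
      show "dual_dist_on V (restrict_functional V xs) (restrict_functional V ys) = dist xs ys"
        if "xs \<in> Y" "ys \<in> Y" for xs ys
      proof -
        have "dual_dist_on V (restrict_functional V xs) (restrict_functional V ys) =
            (SUP v\<in>{v\<in>V. norm v \<le> 1}. \<bar>blinfun_apply (xs - ys) v\<bar>)"
          unfolding dual_dist_on_def dual_norm_on_def restrict_functional_def
          by (intro SUP_cong) (auto simp: blinfun.diff_left)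
        also have "\<dots> = norm (xs - ys)"
          using that by (intro dual_norm_on_norming[OF sV nrm] subspace_diff[OF sY])
        finally show ?thesis by (simp add: dist_norm)
      qed
    qed
    fix v assume v: "v \<in> V"
    have 1: "restrict_functional V ` frechet_subdiff f v \<subseteq> frechet_subdiff_on V f v"
    proof
      fix h assume "h \<in> restrict_functional V ` frechet_subdiff f v"
      then obtain xs where xs: "h = restrict_functional V xs" "frechet_subgradient_on UNIV f v (blinfun_apply xs)"
        unfolding frechet_subdiff_def by blast
      then have "frechet_subgradient_on V f v (blinfun_apply xs)"
        by (blast intro: frechet_subgradient_on_subset)
      then have "frechet_subgradient_on V f v h"
        by (subst frechet_subgradient_on_cong[of V h "blinfun_apply xs"])
          (simp_all add: xs(1) restrict_functional_def)
      then show "h \<in> frechet_subdiff_on V f v"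
        using restrict_functional_in_dual_on[OF sV] by (simp add: frechet_subdiff_on_def xs(1))
    qed
    \<comment> \<open>Represented by an element of \<open>Y\<close>, a subgradient on
      \<open>V\<close> lifts through the witnesses. Since the intersection with \<open>Y\<close>
      only shrinks the image, this closes a cycle of inclusions and gives both equalities.\<close>
    have 2: "frechet_subdiff_on V f v \<subseteq> restrict_functional V ` (frechet_subdiff f v \<inter> Y)"
    proof
      fix h assume "h \<in> frechet_subdiff_on V f v"
      then have h: "h \<in> dual_on V" "frechet_subgradient_on V f v h" by (simp_all add: frechet_subdiff_on_def)
      obtain y where y: "y \<in> Y" "restrict_functional V y = h" "\<forall>v\<in>V. blinfun_apply y v = h v"
        using onto[OF h(1)] by blast
      have "frechet_subgradient_on V f v (blinfun_apply y)"
        using frechet_subgradient_on_cong[of V "blinfun_apply y" h] y(3) h(2) by simp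
      then have "frechet_subgradient_on UNIV f v (blinfun_apply y)"
        by (rule frechet_subgradient_extend[OF not_minus_infinity sV wit v y(1)])
      then show "h \<in> restrict_functional V ` (frechet_subdiff f v \<inter> Y)"
        using y(1,2) unfolding frechet_subdiff_def by blast
    qed
    show "restrict_functional V ` (frechet_subdiff f v \<inter> Y) = restrict_functional V ` frechet_subdiff f v"
      "restrict_functional V ` frechet_subdiff f v = frechet_subdiff_on V f v"
      using 1 2 by blast+
  qed
qed

end
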